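(* Let $p$ be a prime with $p\equiv 7\pmod{12}$, or $p\in\{37,61,73,109,157,181,229,277\}$. Then for every $u\equiv 8,16\pmod{24}$ there exists a 2-D $(u\times 2p,4,2)$-OOC with exactly $J^*(u\times 2p)=\left\lfloor\frac{u}{4}\left(\left\lfloor\frac{2up-1}{3}\left\lfloor\frac{2up-2}{2}\right\rfloor\right\rfloor-1\right)\right\rfloor$ codewords.
   Context: A 2-D $(u\times v,4,2)$-OOC is a family $\mathcal C$ of $u\times v$ $(0,1)$-matrices of Hamming weight $4$ such that for all $A=(a_{ij}),B=(b_{ij})\in\mathcal C$ and integers $r$ with $A\ne B$ or $r\not\equiv0\pmod v$, $\sum_{i,j}a_{ij}b_{i,j+r}\le 2$ (column indices mod $v$). *)

theory Defs
  imports Complex_Main "HOL-Number_Theory.Number_Theory"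
begin

text \<open>A u x v (0,1)-matrix is represented by its support: the set of cells (i,j)
  with i < u, j < v carrying a 1.  Hamming weight = cardinality of the support.\<close>

definition ooc_matrix :: "nat \<Rightarrow> nat \<Rightarrow> (nat \<times> nat) set \<Rightarrow> bool" where
  "ooc_matrix u v A \<longleftrightarrow> A \<subseteq> {0..<u} \<times> {0..<v} \<and> card A = 4"

definition corr :: "nat \<Rightarrow> (nat \<times> nat) set \<Rightarrow> (nat \<times> nat) set \<Rightarrow> int \<Rightarrow> nat" where
  "corr v A B r = card {(i,j) \<in> A. (i, nat ((int j + r) mod int v)) \<in> B}"

definition is_2D_OOC :: "nat \<Rightarrow> nat \<Rightarrow> (nat \<times> nat) set set \<Rightarrow> bool" where
  "is_2D_OOC u v C \<longleftrightarrow>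
     (\<forall>A\<in>C. ooc_matrix u v A) \<and>
     (\<forall>A\<in>C. \<forall>B\<in>C. \<forall>r::int. (A \<noteq> B \<or> r mod int v \<noteq> 0) \<longrightarrow> corr v A B r \<le> 2)"

definition J_star :: "nat \<Rightarrow> nat \<Rightarrow> int" where
  "J_star u p = \<lfloor>(real u / 4) *
      (real_of_int \<lfloor>((2 * real u * real p - 1) / 3) * real_of_int \<lfloor>(2 * real u * real p - 2) / 2\<rfloor>\<rfloor> - 1)\<rfloor>"

end

theory Submission
  imports Defs
begin

text \<open>
  An optimal code is read off a Steiner quadruple system on \<^term>\<open>{0..<u} \<times> {0..<2 * p}\<close> that is
  invariant under column shifts: each full shift orbit of blocks contributes one codeword.
  Two cells of one row in columns \<open>j\<close> and \<open>j + p\<close> lie in an odd number of blocks, and the shift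
  by \<^term>\<open>p\<close> permutes these, so it fixes at least one of them; the bound is attained exactly
  when each such pair lies in only one such short block.

  Such a system arises by the doubling construction from one on \<^term>\<open>{0..<u} \<times> {0..<p}\<close> whose
  blocks are shift invariant, gluing the two copies along a one-factorization whose factors are
  matched by an involution with a single fixed factor; only this factor produces short
  blocks.  Ordinary shift invariant doubling removes the powers of two from \<^term>\<open>u\<close> and leaves a
  system on \<open>4 k p\<close> points with \<open>k p\<close> coprime to 6.  For every \<open>n\<close> coprime to 6 there is an
  explicit translation invariant quadruple system on four copies of \<open>\<int>/n\<close>, given by linear
  equations.
\<close>

section \<open>Steiner quadruple systems\<close>

text \<open>With N = 2up cells a quadruple system has N(N-1)(N-2)/24 blocks. A pair of cells p
  columns apart lies in (N-2)/2 = up - 1 blocks, an odd number because u is even. There are up such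
  pairs and a short block holds two of them, so one short block per pair makes N/4 short blocks. All
  other orbits have length 2p, and (N(N-1)(N-2)/24 - N/4)/(2p) = u((N-1)(N-2)/6 - 1)/4: the inner -1
  in \<open>J_star\<close> is the one unavoidable short block. Doubling fits the period 2p because p
  is odd: Z/2p is Z/p x Z/2, the two copies are the even and the odd columns, and the shift by 1 is
  the shift modulo p combined with an exchange of the copies. The glued blocks survive this exchange
  if the matching of factors is an involution commuting with the shift. The number up - 1 of factors
  is odd, so every involution fixes at least one of them; a single fixed factor is the best
  possible. Coprimality to 6 enters twice: the linear equations divide by 2 and 3, and no block can
  have a stabilizer of order 3 or 4.\<close>

definition sqs :: "'a set \<Rightarrow> 'a set set \<Rightarrow> bool" where
  "sqs P \<B> \<longleftrightarrow> finite P \<and> (\<forall>B\<in>\<B>. B \<subseteq> P \<and> card B = 4) \<and>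
     (\<forall>x\<in>P. \<forall>y\<in>P. \<forall>z\<in>P. distinct [x, y, z] \<longrightarrow> (\<exists>!B. B \<in> \<B> \<and> {x, y, z} \<subseteq> B))"

lemma sqs_block: "sqs P \<B> \<Longrightarrow> B \<in> \<B> \<Longrightarrow> B \<subseteq> P" "sqs P \<B> \<Longrightarrow> B \<in> \<B> \<Longrightarrow> card B = 4"
  by (simp_all add: sqs_def)

lemma sqs_triple:
  assumes "sqs P \<B>" "x \<in> P" "y \<in> P" "z \<in> P" "distinct [x, y, z]"
  obtains B where "B \<in> \<B>" "{x, y, z} \<subseteq> B" "\<And>B'. B' \<in> \<B> \<Longrightarrow> {x, y, z} \<subseteq> B' \<Longrightarrow> B' = B"
proof -
  have "\<exists>!B. B \<in> \<B> \<and> {x, y, z} \<subseteq> B"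
    using assms(1) unfolding sqs_def using assms(2-5) by simp
  then show ?thesis using that by (elim ex1E conjE) blast
qed

text \<open>Lets each system be built on the point set where its symmetry is easiest to state and be
  renamed to cells afterwards.\<close>

lemma sqs_image:
  assumes "sqs P \<B>" "bij_betw f P Q"
  shows "sqs Q ((`) f ` \<B>)"
proof -
  note S = assms(1)[unfolded sqs_def]
  have inj: "inj_on f P" and im: "f ` P = Q" using assms(2) by (auto simp: bij_betw_def)
  have 1: "f ` B \<subseteq> Q \<and> card (f ` B) = 4" if "B \<in> \<B>" for B
    using S that im inj by (metis card_image image_mono inj_on_subset)
  have 2: "\<exists>!B'. B' \<in> (`) f ` \<B> \<and> {x, y, z} \<subseteq> B'"
    if xyz: "x \<in> Q" "y \<in> Q" "z \<in> Q" "distinct [x, y, z]" for x y z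
  proof -
    obtain a b c where abc: "a \<in> P" "b \<in> P" "c \<in> P" "x = f a" "y = f b" "z = f c"
      using xyz(1-3) unfolding im[symmetric] by (elim imageE)
    have iff: "{x, y, z} \<subseteq> f ` B \<longleftrightarrow> {a, b, c} \<subseteq> B" if "B \<in> \<B>" for B
    proof -
      have "B \<subseteq> P" using sqs_block[OF assms(1)] that by blast
      then show ?thesis using abc inj_on_image_mem_iff[OF inj] by auto
    qed
    have "distinct [a, b, c]" using abc that by auto
    then obtain B where B: "B \<in> \<B>" "{a, b, c} \<subseteq> B"
      "\<And>B'. B' \<in> \<B> \<Longrightarrow> {a, b, c} \<subseteq> B' \<Longrightarrow> B' = B"
      using sqs_triple[OF assms(1) abc(1-3)] by blast
    show ?thesis
    proof (rule ex1I[of _ "f ` B"])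
      show "f ` B \<in> (`) f ` \<B> \<and> {x, y, z} \<subseteq> f ` B" using B(1,2) iff by blast
      fix B' assume "B' \<in> (`) f ` \<B> \<and> {x, y, z} \<subseteq> B'"
      then obtain B'' where "B'' \<in> \<B>" "B' = f ` B''" "{x, y, z} \<subseteq> f ` B''" by auto
      then show "B' = f ` B" using iff B(3) by auto
    qed
  qed
  have "finite Q" using S im by auto
  then show ?thesis unfolding sqs_def using 1 2 by auto
qed

lemma sqs_finite: "sqs P \<B> \<Longrightarrow> finite \<B>"
  unfolding sqs_def by (meson Pow_iff finite_Pow_iff finite_subset subsetI)

text \<open>Source of the correlation bound: a shifted codeword and another codeword are both
  blocks, so a correlation of 3 makes them equal.\<close>

lemma sqs_unique:
  assumes "sqs P \<B>" "A \<in> \<B>" "B \<in> \<B>" "card (A \<inter> B) \<ge> 3"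
  shows "A = B"
proof -
  obtain T where T: "T \<subseteq> A \<inter> B" "card T = 3"
    using assms(4) by (meson obtain_subset_with_card_n)
  then obtain x y z where xyz: "T = {x, y, z}" "x \<noteq> y" "x \<noteq> z" "y \<noteq> z"
    by (auto simp: card_3_iff)
  moreover have "A \<subseteq> P" using assms by (auto simp: sqs_def)
  ultimately have P: "x \<in> P" "y \<in> P" "z \<in> P" "distinct [x, y, z]" and "{x, y, z} \<subseteq> A" "{x, y, z} \<subseteq> B"
    using T by auto
  then show ?thesis using sqs_triple[OF assms(1) P] assms(2,3) by metis
qed

text \<open>Double counting of triples: a block holds four of them, and distinct blocks share
  none.\<close>

lemma card_sqs:
  assumes "sqs P \<B>"
  shows "4 * card \<B> = card P choose 3"
proof -
  note S = assms[unfolded sqs_def]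
  define \<T> where "\<T> B = {T. T \<subseteq> B \<and> card T = 3}" for B :: "'a set"
  have fin: "finite B" "card B = 4" if "B \<in> \<B>" for B
    using sqs_block[OF assms] that by (metis card.infinite zero_neq_numeral)+
  have card_T: "card (\<T> B) = 4" if "B \<in> \<B>" for B
    using n_subsets[OF fin(1)[OF that], of 3] fin(2)[OF that]
    by (simp add: \<T>_def numeral_eq_Suc)
  have disj: "\<T> A \<inter> \<T> B = {}" if "A \<in> \<B>" "B \<in> \<B>" "A \<noteq> B" for A B
  proof (rule ccontr)
    assume "\<T> A \<inter> \<T> B \<noteq> {}"
    then obtain T where "T \<subseteq> A \<inter> B" "card T = 3" by (auto simp: \<T>_def)
    then have "card (A \<inter> B) \<ge> 3" using fin that by (metis card_mono finite_Int)
    then show False using sqs_unique[OF assms] that by blast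
  qed
  have inj: "inj_on \<T> \<B>"
    by (rule inj_onI) (metis disj card_T card.empty inf.idem zero_neq_numeral)
  have un: "\<Union>(\<T> ` \<B>) = {T. T \<subseteq> P \<and> card T = 3}"
  proof (intro equalityI subsetI)
    fix T assume "T \<in> {T. T \<subseteq> P \<and> card T = 3}"
    then obtain x y z where "T = {x, y, z}" "distinct [x, y, z]" "T \<subseteq> P"
      by (auto simp: card_3_iff)
    moreover from this have "x \<in> P" "y \<in> P" "z \<in> P" by auto
    ultimately obtain B where "B \<in> \<B>" "T \<subseteq> B"
      using sqs_triple[OF assms] by metis
    then show "T \<in> \<Union>(\<T> ` \<B>)" using \<open>T = {x, y, z}\<close> \<open>distinct [x, y, z]\<close>
      by (auto simp: \<T>_def)
  qed (use S in \<open>auto simp: \<T>_def\<close>)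
  have "4 * card (\<T> ` \<B>) = card (\<Union>(\<T> ` \<B>))"
  proof (rule card_partition)
    show "finite (\<Union>(\<T> ` \<B>))" unfolding un using S by simp
  qed (use sqs_finite[OF assms] card_T disj in auto)
  then show ?thesis
    unfolding un using n_subsets[of P 3] S inj by (simp add: card_image)
qed

section \<open>Column shifts and stabilizers of blocks\<close>

definition rot :: "nat \<Rightarrow> nat \<Rightarrow> nat \<times> nat \<Rightarrow> nat \<times> nat" where
  "rot v r = (\<lambda>(i, x). (i, (x + r) mod v))"

definition cyclic_sqs :: "nat \<Rightarrow> nat \<Rightarrow> (nat \<times> nat) set set \<Rightarrow> bool" where
  "cyclic_sqs u v \<B> \<longleftrightarrow> sqs ({0..<u} \<times> {0..<v}) \<B> \<and> (\<forall>B\<in>\<B>. rot v 1 ` B \<in> \<B>)"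

lemma rot_rot: "rot v r (rot v s q) = rot v (r + s) q"
  by (auto simp: rot_def mod_simps ac_simps split: prod.splits)

lemma rot_image_image: "rot v r ` rot v s ` A = rot v (r + s) ` A"
  by (simp add: image_image rot_rot)

lemma rot_mod: "rot v (r mod v) = rot v r"
  by (auto simp: rot_def mod_simps)

lemma rot_id: "A \<subseteq> {0..<u} \<times> {0..<v} \<Longrightarrow> v dvd r \<Longrightarrow> rot v r ` A = A"
  by (force simp: rot_def image_iff)

lemma rot_inj: "inj_on (rot v r) ({0..<u} \<times> {0..<v})"
proof (rule inj_onI, clarsimp simp: rot_def)
  fix x y assume "x < v" "y < v" "(x + r) mod v = (y + r) mod v"
  then show "x = y" by (metis cong_add_rcancel_nat cong_def mod_less)
qed

lemma cyclic_sqs_rot: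
  assumes "cyclic_sqs u v \<B>" "B \<in> \<B>"
  shows "rot v r ` B \<in> \<B>"
proof (induction r)
  case 0
  have "B \<subseteq> {0..<u} \<times> {0..<v}" using assms by (auto simp: cyclic_sqs_def sqs_def)
  then show ?case using assms(2) by (simp add: rot_id)
next
  case (Suc r)
  then have "rot v 1 ` rot v r ` B \<in> \<B>" using assms by (auto simp: cyclic_sqs_def)
  then show ?case by (simp add: rot_image_image)
qed

text \<open>If \<open>2 * r\<close> is not 0 modulo \<open>2 * p\<close>, then neither are
  \<open>r\<close>, \<open>3 * r\<close>, \<open>4 * r\<close>, since p is prime to 6; a point of A
  then has five distinct images in A, which has only four elements. If it is 0 while r is not, then
  r is congruent to p. Hence p is the only shift that has to be tested for a short orbit.\<close>

lemma rot_stabilizer: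
  assumes "card A = 4" "A \<subseteq> {0..<u} \<times> {0..<2 * p}" "coprime p 6" "rot (2 * p) r ` A = A"
    "\<not> 2 * p dvd r"
  shows "rot (2 * p) p ` A = A"
proof -
  let ?v = "2 * p"
  have "coprime p 2" using assms(3) by (rule coprime_divisors[rotated 2]) auto
  then have "odd p" by simp
  obtain a where a: "a \<in> A" using assms(1) by (metis card.empty ex_in_conv zero_neq_numeral)
  have mem: "rot ?v (k * r) q \<in> A" if "q \<in> A" for k q
  proof (induction k)
    case 0
    have "snd q < ?v" using that assms(2) by auto
    then show ?case using that by (cases q) (simp add: rot_def)
  next
    case (Suc k)
    then have "rot ?v r (rot ?v (k * r) q) \<in> A" using assms(4) by blast
    then show ?case by (simp add: rot_rot)
  qed
  have fix_iff: "rot ?v j q = rot ?v k q \<longleftrightarrow> [j = k] (mod ?v)" if "q \<in> A" for j k q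
  proof -
    have "snd q < ?v" using that assms(2) by auto
    then show ?thesis
      by (auto simp: rot_def cong_def split: prod.splits)
        (metis cong_add_lcancel_nat cong_def)+
  qed
  show ?thesis
  proof (cases "?v dvd 2 * r")
    case True
    then have "p dvd r" by simp
    then obtain k where k: "r = p * k" by blast
    with assms(5) have "odd k" by (auto elim: evenE)
    then obtain j where "k = 2 * j + 1" by (elim oddE)
    then have "r = p + ?v * j" using k by (simp add: algebra_simps)
    then have "rot ?v r = rot ?v p" by (metis rot_mod mod_mult_self2)
    then show ?thesis using assms(4) by simp
  next
    case False
    have cop3: "coprime ?v 3"
    proof -
      have "coprime p 3" using assms(3) by (rule coprime_divisors[rotated 2]) auto
      then show ?thesis by simp
    qed
    have n1: "\<not> [1 * r = 0 * r] (mod ?v)" and n2: "\<not> [2 * r = 0 * r] (mod ?v)"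
      using assms(5) False by (auto simp: cong_0_iff)
    have n3: "\<not> [3 * r = 0 * r] (mod ?v)"
      using assms(5) cop3 by (simp add: cong_0_iff coprime_dvd_mult_right_iff)
    have n4: "\<not> [4 * r = 0 * r] (mod ?v)"
    proof
      assume "[4 * r = 0 * r] (mod ?v)"
      then have "?v dvd 2 * (2 * r)" by (simp add: cong_0_iff)
      then have "p dvd 2 * r" by simp
      then have "p dvd r" using \<open>odd p\<close> by (simp add: coprime_dvd_mult_right_iff)
      then show False using False by simp
    qed
    have ne: "rot ?v (j * r) a \<noteq> rot ?v (k * r) a" if "j < k" "k \<le> 4" for j k
    proof -
      have "\<not> [(k - j) * r = 0 * r] (mod ?v)"
      proof -
        have "k - j = 1 \<or> k - j = 2 \<or> k - j = 3 \<or> k - j = 4" using that by auto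
        then show ?thesis using n1 n2 n3 n4 by metis
      qed
      then have "\<not> [j * r + 0 = j * r + (k - j) * r] (mod ?v)"
        unfolding cong_add_lcancel_nat by (simp add: cong_sym_eq)
      moreover have "j * r + (k - j) * r = k * r" using that by (simp flip: add_mult_distrib)
      ultimately show ?thesis using fix_iff[OF a] by simp
    qed
    have "inj_on (\<lambda>k. rot ?v (k * r) a) {0..4}"
      by (rule inj_onI) (metis atLeastAtMost_iff linorder_neqE_nat ne)
    moreover have "(\<lambda>k. rot ?v (k * r) a) ` {0..4} \<subseteq> A" using mem[OF a] by blast
    moreover have "finite A" using assms(1) by (metis card.infinite zero_neq_numeral)
    ultimately have "card {0..4::nat} \<le> card A" by (metis card_image card_mono)
    then show ?thesis using assms(1) by simp
  qed
qed

section \<open>A quadruple system on four copies of a cyclic group\<close>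

definition res :: "int \<Rightarrow> int set" where "res n = {0..<n}"
text \<open>In each of the four relations defined here the coefficients sum to 0, which makes it
  translation invariant, and every coefficient is 1, 2 or 3 up to sign, so that any variable is
  determined by the others modulo n. With \<open>z = w\<close> this one says that z is the midpoint
  of x and y.\<close>

definition eq4 :: "int \<Rightarrow> int \<Rightarrow> int \<Rightarrow> int \<Rightarrow> int \<Rightarrow> bool" where
  "eq4 n x y z w \<longleftrightarrow> n dvd x + y - z - w"
text \<open>The point z = (2x + y)/3, nearer to x than to y: the order of the first two arguments
  matters.\<close>

definition third :: "int \<Rightarrow> int \<Rightarrow> int \<Rightarrow> int \<Rightarrow> bool" where
  "third n x y z \<longleftrightarrow> n dvd 2 * x + y - 3 * z"
definition cent :: "int \<Rightarrow> int \<Rightarrow> int \<Rightarrow> int \<Rightarrow> int \<Rightarrow> bool" where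
  "cent n x y z w \<longleftrightarrow> n dvd x + y + z - 3 * w"
text \<open>For blocks with one cell in each copy, weighted 1 on side L and 2 on side R. With
  \<open>y = w\<close> the relation becomes y = (x + 2z)/3, that is \<open>third n z x y\<close>,
  the degenerate case taken over by \<open>T0\<close> and \<open>T1\<close>.\<close>

definition trav :: "int \<Rightarrow> int \<Rightarrow> int \<Rightarrow> int \<Rightarrow> int \<Rightarrow> bool" where
  "trav n x y z w \<longleftrightarrow> n dvd x - y + 2 * z - 2 * w"

datatype side = L | R

fun opp :: "side \<Rightarrow> side" where
  "opp L = R"
| "opp R = L"

lemma opp_opp [simp]: "opp (opp i) = i"
  by (cases i) auto

lemma opp_eq_iff [simp]: "opp i = opp j \<longleftrightarrow> i = j" "opp i = j \<longleftrightarrow> i \<noteq> j" "i = opp j \<longleftrightarrow> i \<noteq> j"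
  by (cases i; cases j; simp)+

lemma side_neq_iff [simp]: "i \<noteq> L \<longleftrightarrow> i = R" "i \<noteq> R \<longleftrightarrow> i = L" "L \<noteq> i \<longleftrightarrow> i = R" "R \<noteq> i \<longleftrightarrow> i = L"
  by (cases i; simp)+

type_synonym cell = "(side \<times> side) \<times> int"

text \<open>
  The rules \<open>A\<close>, \<open>P\<close>, \<open>B\<close>, \<open>C\<close> are the generic linear blocks.  They break down when the
  computed fourth point coincides with one of the given three, as for the midpoint in
  \<open>x + y = 2 z\<close> or the two points dividing a segment in the ratio \<open>1 : 2\<close>.  The rules \<open>M\<close>, \<open>T0\<close>, \<open>T1\<close>
  cover these triples; the inequalities in \<open>P\<close> and \<open>C\<close> discard precisely the generic blocks
  whose triples are thereby covered a second time.
\<close>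

inductive_set quad :: "int \<Rightarrow> cell set set" for n :: int where
  A: "\<lbrakk>x \<in> res n; y \<in> res n; z \<in> res n; w \<in> res n; x \<noteq> y; y \<noteq> z; x \<noteq> z; cent n x y z w\<rbrakk>
      \<Longrightarrow> {((c, i), x), ((c, i), y), ((c, i), z), ((c, opp i), w)} \<in> quad n"
| P: "\<lbrakk>x \<in> res n; y \<in> res n; z \<in> res n; w \<in> res n; x \<noteq> y; z \<noteq> w; x \<noteq> z; x \<noteq> w; y \<noteq> z; y \<noteq> w; eq4 n x y z w\<rbrakk>
      \<Longrightarrow> {((L, i), x), ((L, i), y), ((R, i), z), ((R, i), w)} \<in> quad n"
| B: "\<lbrakk>x \<in> res n; y \<in> res n; z \<in> res n; w \<in> res n; x \<noteq> y; z \<noteq> w; eq4 n x y z w\<rbrakk>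
      \<Longrightarrow> {((L, i), x), ((L, i), y), ((R, opp i), z), ((R, opp i), w)} \<in> quad n"
| M: "\<lbrakk>x \<in> res n; y \<in> res n; z \<in> res n; x \<noteq> y; eq4 n x y z z\<rbrakk>
      \<Longrightarrow> {((c, i), x), ((c, i), y), ((opp c, i), z), ((opp c, opp i), z)} \<in> quad n"
| T0: "\<lbrakk>x \<in> res n; y \<in> res n; z \<in> res n; x \<noteq> y; third n x y z\<rbrakk>
      \<Longrightarrow> {((L, i), x), ((L, i), y), ((L, opp i), z), ((R, i), x)} \<in> quad n"
| T1: "\<lbrakk>x \<in> res n; y \<in> res n; z \<in> res n; x \<noteq> y; third n x y z\<rbrakk>
      \<Longrightarrow> {((R, i), x), ((R, i), y), ((R, opp i), z), ((L, i), y)} \<in> quad n"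
| C: "\<lbrakk>x \<in> res n; y \<in> res n; z \<in> res n; w \<in> res n; x \<noteq> y; x \<noteq> z; y \<noteq> w; trav n x y z w\<rbrakk>
      \<Longrightarrow> {((L, i), x), ((L, opp i), y), ((R, i), z), ((R, opp i), w)} \<in> quad n"
| D: "x \<in> res n \<Longrightarrow> {((L, i), x), ((L, opp i), x), ((R, i), x), ((R, opp i), x)} \<in> quad n"

lemma card_quad: "B \<in> quad n \<Longrightarrow> B \<subseteq> UNIV \<times> res n \<and> card B = 4"
  by (induction rule: quad.induct) auto

lemma finite_res [simp]: "finite (res n)" by (simp add: res_def)

locale coprime_six =
  fixes n :: int
  assumes n: "n > 0" "coprime n 6"
begin

section \<open>Linear equations modulo n\<close>

lemma res_cancel:
  assumes "a \<in> res n" "b \<in> res n" "n dvd c * (a - b)" "c dvd 6"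
  shows "a = b"
proof -
  have "coprime n c" using n(2) assms(4) by (meson coprime_divisors dvd_refl)
  then have "n dvd a - b" using assms(3) by (simp add: coprime_dvd_mult_right_iff)
  then have "a mod n = b mod n" by (simp add: mod_eq_dvd_iff)
  then show ?thesis using assms(1,2) by (simp add: res_def)
qed

lemma res_solve:
  assumes "c dvd 6"
  obtains a where "a \<in> res n" "n dvd e - c * a"
proof -
  have "coprime c n" using n(2) assms(1) by (metis coprime_commute coprime_divisors dvd_refl)
  then obtain d where "[c * d = 1] (mod n)" using cong_solve_coprime_int by auto
  then have "[c * (d * e) = e] (mod n)" by (metis cong_scalar_right mult.assoc mult_1)
  then have "[c * (d * e mod n) = e] (mod n)"
    by (metis cong_def mod_mult_right_eq)
  then have "n dvd e - c * (d * e mod n)" by (meson cong_iff_dvd_diff cong_sym)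
  then show ?thesis using n(1) that[of "d * e mod n"] by (simp add: res_def)
qed

lemma res_solve':
  assumes "c dvd 6"
  obtains a where "a \<in> res n" "n dvd c * a - e"
  using res_solve[OF assms, of e] by (metis dvd_diff_commute)

text \<open>Template for all uniqueness facts below: subtracting two instances of a relation leaves
  c times the difference of the single variable that changed.\<close>

lemma cancelI:
  "a \<in> res n \<Longrightarrow> b \<in> res n \<Longrightarrow> n dvd p \<Longrightarrow> n dvd q \<Longrightarrow> c * (a - b) = p - q \<Longrightarrow> c dvd 6 \<Longrightarrow> a = b"
  using res_cancel[of a b c] by (metis dvd_diff)

lemma cancelI':
  "a \<in> res n \<Longrightarrow> b \<in> res n \<Longrightarrow> n dvd p \<Longrightarrow> c * (a - b) = p \<Longrightarrow> c dvd 6 \<Longrightarrow> a = b"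
  using res_cancel[of a b c] by metis

lemma eq4_sym: "eq4 n y x z w \<longleftrightarrow> eq4 n x y z w" "eq4 n x y w z \<longleftrightarrow> eq4 n x y z w" "eq4 n z w x y \<longleftrightarrow> eq4 n x y z w"
    apply (simp_all add: eq4_def algebra_simps)
  by (metis (no_types, opaque_lifting) add_diff_eq diff_diff_eq dvd_diff_commute)

lemma eq4_4: "\<lbrakk>eq4 n x y z w; eq4 n x y z w'; w \<in> res n; w' \<in> res n\<rbrakk> \<Longrightarrow> w = w'"
  unfolding eq4_def by (erule cancelI[of _ _ _ _ "-1", rotated 2]) auto

lemma eq4_same: "\<lbrakk>eq4 n x y x w; y \<in> res n; w \<in> res n\<rbrakk> \<Longrightarrow> w = y"
  unfolding eq4_def by (rule cancelI'[of _ _ _ "-1"]) auto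

lemma eq4_double: "\<lbrakk>eq4 n x x z z; x \<in> res n; z \<in> res n\<rbrakk> \<Longrightarrow> x = z"
  unfolding eq4_def by (erule cancelI'[of _ _ _ 2, rotated 2]) auto

lemma eq4_distinct:
  assumes "eq4 n x y z w" "x \<in> res n" "y \<in> res n" "z \<in> res n" "z \<noteq> x" "z \<noteq> y"
  shows "w \<noteq> x" "w \<noteq> y"
  using assms eq4_same[of x y z] eq4_same[of y x z] by (auto simp: eq4_sym)

lemma third_1: "\<lbrakk>third n x y z; third n x' y z; x \<in> res n; x' \<in> res n\<rbrakk> \<Longrightarrow> x = x'"
  unfolding third_def by (erule cancelI[of _ _ _ _ 2, rotated 2]) auto

lemma third_2: "\<lbrakk>third n x y z; third n x y' z; y \<in> res n; y' \<in> res n\<rbrakk> \<Longrightarrow> y = y'"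
  unfolding third_def by (erule cancelI[of _ _ _ _ 1, rotated 2]) auto

lemma third_3: "\<lbrakk>third n x y z; third n x y z'; z \<in> res n; z' \<in> res n\<rbrakk> \<Longrightarrow> z = z'"
  unfolding third_def by (erule cancelI[of _ _ _ _ "-3", rotated 2]) auto

lemma third_swap: "\<lbrakk>third n x y z; third n y x z; x \<in> res n; y \<in> res n\<rbrakk> \<Longrightarrow> x = y"
  unfolding third_def by (erule cancelI[of _ _ _ _ 1, rotated 2]) auto

lemma third_13: "\<lbrakk>third n x y x; x \<in> res n; y \<in> res n\<rbrakk> \<Longrightarrow> x = y"
  unfolding third_def by (erule cancelI'[of _ _ _ "-1", rotated 2]) auto

lemma third_23: "\<lbrakk>third n x y y; x \<in> res n; y \<in> res n\<rbrakk> \<Longrightarrow> x = y"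
  unfolding third_def by (erule cancelI'[of _ _ _ 2, rotated 2]) auto

lemma third_double: "\<lbrakk>third n x x z; x \<in> res n; z \<in> res n\<rbrakk> \<Longrightarrow> x = z"
  unfolding third_def by (erule cancelI'[of _ _ _ 3, rotated 2]) auto

lemma cent_sym: "cent n y x z w \<longleftrightarrow> cent n x y z w" "cent n x z y w \<longleftrightarrow> cent n x y z w"
  by (simp_all add: cent_def algebra_simps)

lemma cent_3: "\<lbrakk>cent n x y z w; cent n x y z' w; z \<in> res n; z' \<in> res n\<rbrakk> \<Longrightarrow> z = z'"
  unfolding cent_def by (erule cancelI[of _ _ _ _ 1, rotated 2]) auto

lemma cent_4: "\<lbrakk>cent n x y z w; cent n x y z w'; w \<in> res n; w' \<in> res n\<rbrakk> \<Longrightarrow> w = w'"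
  unfolding cent_def by (erule cancelI[of _ _ _ _ "-3", rotated 2]) auto

lemma cent_third: "cent n x y x w \<longleftrightarrow> third n x y w" "cent n x y y w \<longleftrightarrow> third n y x w"
  by (simp_all add: cent_def third_def algebra_simps)

lemma trav_2: "\<lbrakk>trav n x y z w; trav n x y' z w; y \<in> res n; y' \<in> res n\<rbrakk> \<Longrightarrow> y = y'"
  unfolding trav_def by (erule cancelI[of _ _ _ _ "-1", rotated 2]) auto

lemma trav_4: "\<lbrakk>trav n x y z w; trav n x y z w'; w \<in> res n; w' \<in> res n\<rbrakk> \<Longrightarrow> w = w'"
  unfolding trav_def by (erule cancelI[of _ _ _ _ "-2", rotated 2]) auto

lemma trav_flip: "trav n y x w z \<longleftrightarrow> trav n x y z w"
  unfolding trav_def by (subst dvd_minus_iff[symmetric]) (simp add: algebra_simps)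

lemma trav_third: "trav n x y z y \<longleftrightarrow> third n z x y" "trav n x y x w \<longleftrightarrow> third n w y x"
  unfolding trav_def third_def by (simp_all add: algebra_simps, metis (no_types, opaque_lifting) diff_diff_eq dvd_diff_commute diff_add_eq)

lemma trav_12: "\<lbrakk>trav n x x z w; z \<in> res n; w \<in> res n\<rbrakk> \<Longrightarrow> z = w"
  unfolding trav_def by (erule cancelI'[of _ _ _ 2, rotated 2]) auto

lemma trav_34: "\<lbrakk>trav n x y z z; x \<in> res n; y \<in> res n\<rbrakk> \<Longrightarrow> x = y"
  unfolding trav_def by (erule cancelI'[of _ _ _ 1, rotated 2]) auto

text \<open>Blocks have four cells, so one that contains T and d can only be
  \<open>insert d T\<close>. Uniqueness is thereby reduced to showing that the fourth cell is
  forced.\<close>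

lemma quad_ex1:
  assumes "insert d T \<in> quad n" "d \<notin> T" "\<And>B. B \<in> quad n \<Longrightarrow> T \<subseteq> B \<Longrightarrow> d \<in> B"
  shows "\<exists>!B. B \<in> quad n \<and> T \<subseteq> B"
proof (rule ex1I[of _ "insert d T"])
  fix B assume "B \<in> quad n \<and> T \<subseteq> B"
  then have "insert d T \<subseteq> B" "card (insert d T) = card B" "finite B"
    using assms card_quad by (auto intro: card_ge_0_finite simp: card_quad)
  then show "B = insert d T" by (metis card_subset_eq)
qed (use assms in auto)

text \<open>Rule inversion for \<open>quad\<close>, spelled out for concrete copies: whether T fits
  into a block is then decided by comparing constructors, and only relations between coordinates
  remain. \<open>C\<close> and \<open>D\<close> need one case each, because both values of i yield
  the same blocks.\<close>

lemma quad_ex1I: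
  assumes "insert d T \<in> quad n" "d \<notin> T"
    and qALL: "\<And>x y z w. \<lbrakk>x \<in> res n; y \<in> res n; z \<in> res n; w \<in> res n; x \<noteq> y; y \<noteq> z; x \<noteq> z; cent n x y z w; T \<subseteq> {((L, L), x), ((L, L), y), ((L, L), z), ((L, R), w)}\<rbrakk>
      \<Longrightarrow> d \<in> {((L, L), x), ((L, L), y), ((L, L), z), ((L, R), w)}"
    and qALR: "\<And>x y z w. \<lbrakk>x \<in> res n; y \<in> res n; z \<in> res n; w \<in> res n; x \<noteq> y; y \<noteq> z; x \<noteq> z; cent n x y z w; T \<subseteq> {((L, R), x), ((L, R), y), ((L, R), z), ((L, L), w)}\<rbrakk>
      \<Longrightarrow> d \<in> {((L, R), x), ((L, R), y), ((L, R), z), ((L, L), w)}"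
    and qARL: "\<And>x y z w. \<lbrakk>x \<in> res n; y \<in> res n; z \<in> res n; w \<in> res n; x \<noteq> y; y \<noteq> z; x \<noteq> z; cent n x y z w; T \<subseteq> {((R, L), x), ((R, L), y), ((R, L), z), ((R, R), w)}\<rbrakk>
      \<Longrightarrow> d \<in> {((R, L), x), ((R, L), y), ((R, L), z), ((R, R), w)}"
    and qARR: "\<And>x y z w. \<lbrakk>x \<in> res n; y \<in> res n; z \<in> res n; w \<in> res n; x \<noteq> y; y \<noteq> z; x \<noteq> z; cent n x y z w; T \<subseteq> {((R, R), x), ((R, R), y), ((R, R), z), ((R, L), w)}\<rbrakk>
      \<Longrightarrow> d \<in> {((R, R), x), ((R, R), y), ((R, R), z), ((R, L), w)}"
    and qPL: "\<And>x y z w. \<lbrakk>x \<in> res n; y \<in> res n; z \<in> res n; w \<in> res n; x \<noteq> y; z \<noteq> w; x \<noteq> z; x \<noteq> w; y \<noteq> z; y \<noteq> w; eq4 n x y z w; T \<subseteq> {((L, L), x), ((L, L), y), ((R, L), z), ((R, L), w)}\<rbrakk>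
      \<Longrightarrow> d \<in> {((L, L), x), ((L, L), y), ((R, L), z), ((R, L), w)}"
    and qPR: "\<And>x y z w. \<lbrakk>x \<in> res n; y \<in> res n; z \<in> res n; w \<in> res n; x \<noteq> y; z \<noteq> w; x \<noteq> z; x \<noteq> w; y \<noteq> z; y \<noteq> w; eq4 n x y z w; T \<subseteq> {((L, R), x), ((L, R), y), ((R, R), z), ((R, R), w)}\<rbrakk>
      \<Longrightarrow> d \<in> {((L, R), x), ((L, R), y), ((R, R), z), ((R, R), w)}"
    and qBL: "\<And>x y z w. \<lbrakk>x \<in> res n; y \<in> res n; z \<in> res n; w \<in> res n; x \<noteq> y; z \<noteq> w; eq4 n x y z w; T \<subseteq> {((L, L), x), ((L, L), y), ((R, R), z), ((R, R), w)}\<rbrakk>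
      \<Longrightarrow> d \<in> {((L, L), x), ((L, L), y), ((R, R), z), ((R, R), w)}"
    and qBR: "\<And>x y z w. \<lbrakk>x \<in> res n; y \<in> res n; z \<in> res n; w \<in> res n; x \<noteq> y; z \<noteq> w; eq4 n x y z w; T \<subseteq> {((L, R), x), ((L, R), y), ((R, L), z), ((R, L), w)}\<rbrakk>
      \<Longrightarrow> d \<in> {((L, R), x), ((L, R), y), ((R, L), z), ((R, L), w)}"
    and qMLL: "\<And>x y z. \<lbrakk>x \<in> res n; y \<in> res n; z \<in> res n; x \<noteq> y; eq4 n x y z z; T \<subseteq> {((L, L), x), ((L, L), y), ((R, L), z), ((R, R), z)}\<rbrakk>
      \<Longrightarrow> d \<in> {((L, L), x), ((L, L), y), ((R, L), z), ((R, R), z)}"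
    and qMLR: "\<And>x y z. \<lbrakk>x \<in> res n; y \<in> res n; z \<in> res n; x \<noteq> y; eq4 n x y z z; T \<subseteq> {((L, R), x), ((L, R), y), ((R, R), z), ((R, L), z)}\<rbrakk>
      \<Longrightarrow> d \<in> {((L, R), x), ((L, R), y), ((R, R), z), ((R, L), z)}"
    and qMRL: "\<And>x y z. \<lbrakk>x \<in> res n; y \<in> res n; z \<in> res n; x \<noteq> y; eq4 n x y z z; T \<subseteq> {((R, L), x), ((R, L), y), ((L, L), z), ((L, R), z)}\<rbrakk>
      \<Longrightarrow> d \<in> {((R, L), x), ((R, L), y), ((L, L), z), ((L, R), z)}"
    and qMRR: "\<And>x y z. \<lbrakk>x \<in> res n; y \<in> res n; z \<in> res n; x \<noteq> y; eq4 n x y z z; T \<subseteq> {((R, R), x), ((R, R), y), ((L, R), z), ((L, L), z)}\<rbrakk>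
      \<Longrightarrow> d \<in> {((R, R), x), ((R, R), y), ((L, R), z), ((L, L), z)}"
    and qT0L: "\<And>x y z. \<lbrakk>x \<in> res n; y \<in> res n; z \<in> res n; x \<noteq> y; third n x y z; T \<subseteq> {((L, L), x), ((L, L), y), ((L, R), z), ((R, L), x)}\<rbrakk>
      \<Longrightarrow> d \<in> {((L, L), x), ((L, L), y), ((L, R), z), ((R, L), x)}"
    and qT0R: "\<And>x y z. \<lbrakk>x \<in> res n; y \<in> res n; z \<in> res n; x \<noteq> y; third n x y z; T \<subseteq> {((L, R), x), ((L, R), y), ((L, L), z), ((R, R), x)}\<rbrakk>
      \<Longrightarrow> d \<in> {((L, R), x), ((L, R), y), ((L, L), z), ((R, R), x)}"
    and qT1L: "\<And>x y z. \<lbrakk>x \<in> res n; y \<in> res n; z \<in> res n; x \<noteq> y; third n x y z; T \<subseteq> {((R, L), x), ((R, L), y), ((R, R), z), ((L, L), y)}\<rbrakk>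
      \<Longrightarrow> d \<in> {((R, L), x), ((R, L), y), ((R, R), z), ((L, L), y)}"
    and qT1R: "\<And>x y z. \<lbrakk>x \<in> res n; y \<in> res n; z \<in> res n; x \<noteq> y; third n x y z; T \<subseteq> {((R, R), x), ((R, R), y), ((R, L), z), ((L, R), y)}\<rbrakk>
      \<Longrightarrow> d \<in> {((R, R), x), ((R, R), y), ((R, L), z), ((L, R), y)}"
    and qC: "\<And>x y z w. \<lbrakk>x \<in> res n; y \<in> res n; z \<in> res n; w \<in> res n; x \<noteq> y; x \<noteq> z; y \<noteq> w; trav n x y z w; T \<subseteq> {((L, L), x), ((L, R), y), ((R, L), z), ((R, R), w)}\<rbrakk>
      \<Longrightarrow> d \<in> {((L, L), x), ((L, R), y), ((R, L), z), ((R, R), w)}"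
    and qD: "\<And>x. \<lbrakk>x \<in> res n; T \<subseteq> {((L, L), x), ((L, R), x), ((R, L), x), ((R, R), x)}\<rbrakk>
      \<Longrightarrow> d \<in> {((L, L), x), ((L, R), x), ((R, L), x), ((R, R), x)}"
  shows "\<exists>!B. B \<in> quad n \<and> T \<subseteq> B"
proof (rule quad_ex1[OF assms(1,2)])
  fix B assume "B \<in> quad n" and T: "T \<subseteq> B"
  then show "d \<in> B"
  proof cases
    case (A x y z w c i)
    show ?thesis using qALL[OF A(2-)] qALR[OF A(2-)] qARL[OF A(2-)] qARR[OF A(2-)] T unfolding A(1) by (cases c; cases i) simp_all
  next
    case (P x y z w i)
    show ?thesis using qPL[OF P(2-)] qPR[OF P(2-)] T unfolding P(1) by (cases i) simp_all
  next
    case (B x y z w i)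
    show ?thesis using qBL[OF B(2-)] qBR[OF B(2-)] T unfolding B(1) by (cases i) simp_all
  next
    case (M x y z c i)
    show ?thesis using qMLL[OF M(2-)] qMLR[OF M(2-)] qMRL[OF M(2-)] qMRR[OF M(2-)] T unfolding M(1) by (cases c; cases i) simp_all
  next
    case (T0 x y z i)
    show ?thesis using qT0L[OF T0(2-)] qT0R[OF T0(2-)] T unfolding T0(1) by (cases i) simp_all
  next
    case (T1 x y z i)
    show ?thesis using qT1L[OF T1(2-)] qT1R[OF T1(2-)] T unfolding T1(1) by (cases i) simp_all
  next
    case (C x y z w i)
    show ?thesis
    proof (cases i)
      case L
      then show ?thesis using qC[OF C(2-)] T unfolding C(1) by simp
    next
      case R
      \<comment> \<open>Exchanging x with y and z with w turns a block with \<open>i = R\<close>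
        into one with \<open>i = L\<close>.\<close>
      have "trav n y x w z" using C trav_flip by simp
      then show ?thesis using qC[of y x w z] C(2-8) T unfolding C(1) R by (simp add: insert_commute)
    qed
  next
    case (D x i)
    show ?thesis using qD[OF D(2)] T unfolding D(1) by (cases i) (simp_all add: insert_commute)
  qed
qed

text \<open>The given triple may meet a block in any order. This and the following lemmas list the
  arrangements as rewrite rules, so that simplification never has to search for a symmetry of the
  relation.\<close>

lemma eq4_char:
  assumes "eq4 n x y z w" "w \<in> res n"
  shows "\<forall>w'\<in>res n. (eq4 n x y z w' \<longleftrightarrow> w' = w) \<and>
    (eq4 n z w' x y \<longleftrightarrow> w' = w) \<and>
    (eq4 n x y w' z \<longleftrightarrow> w' = w) \<and>
    (eq4 n w' z x y \<longleftrightarrow> w' = w) \<and>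
    (eq4 n y x z w' \<longleftrightarrow> w' = w) \<and>
    (eq4 n z w' y x \<longleftrightarrow> w' = w) \<and>
    (eq4 n y x w' z \<longleftrightarrow> w' = w) \<and>
    (eq4 n w' z y x \<longleftrightarrow> w' = w)"
  using assms eq4_4[of x y z w] by (auto simp: eq4_sym)

lemma cent_char:
  assumes "cent n x y z w" "z \<in> res n"
  shows "\<forall>z'\<in>res n. (cent n x y z' w \<longleftrightarrow> z' = z) \<and>
    (cent n x z' y w \<longleftrightarrow> z' = z) \<and>
    (cent n y x z' w \<longleftrightarrow> z' = z) \<and>
    (cent n y z' x w \<longleftrightarrow> z' = z) \<and>
    (cent n z' x y w \<longleftrightarrow> z' = z) \<and>
    (cent n z' y x w \<longleftrightarrow> z' = z)"
proof
  fix z' assume z': "z' \<in> res n"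
  have 1: "cent n x y z' w \<longleftrightarrow> z' = z"
  proof
    assume "cent n x y z' w"
    then show "z' = z" using assms(1) z' assms(2) by (rule cent_3)
  qed (use assms(1) in simp)
  have 2: "cent n x z' y w \<longleftrightarrow> cent n x y z' w"
    "cent n y x z' w \<longleftrightarrow> cent n x y z' w"
    "cent n y z' x w \<longleftrightarrow> cent n x y z' w"
    "cent n z' x y w \<longleftrightarrow> cent n x y z' w"
    "cent n z' y x w \<longleftrightarrow> cent n x y z' w"
    by (simp_all only: cent_def add_ac)
  show "(cent n x y z' w \<longleftrightarrow> z' = z) \<and>
    (cent n x z' y w \<longleftrightarrow> z' = z) \<and>
    (cent n y x z' w \<longleftrightarrow> z' = z) \<and>
    (cent n y z' x w \<longleftrightarrow> z' = z) \<and>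
    (cent n z' x y w \<longleftrightarrow> z' = z) \<and>
    (cent n z' y x w \<longleftrightarrow> z' = z)"
    unfolding 2 by (simp only: 1)
qed

lemma cent_char4:
  assumes "cent n x y z w" "w \<in> res n"
  shows "\<forall>w'\<in>res n. (cent n x y z w' \<longleftrightarrow> w' = w) \<and>
    (cent n x z y w' \<longleftrightarrow> w' = w) \<and>
    (cent n y x z w' \<longleftrightarrow> w' = w) \<and>
    (cent n y z x w' \<longleftrightarrow> w' = w) \<and>
    (cent n z x y w' \<longleftrightarrow> w' = w) \<and>
    (cent n z y x w' \<longleftrightarrow> w' = w)"
proof
  fix w' assume w': "w' \<in> res n"
  have 1: "cent n x y z w' \<longleftrightarrow> w' = w"
  proof
    assume "cent n x y z w'"
    then show "w' = w" using assms(1) w' assms(2) by (rule cent_4)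
  qed (use assms(1) in simp)
  have 2: "cent n x z y w' \<longleftrightarrow> cent n x y z w'"
    "cent n y x z w' \<longleftrightarrow> cent n x y z w'"
    "cent n y z x w' \<longleftrightarrow> cent n x y z w'"
    "cent n z x y w' \<longleftrightarrow> cent n x y z w'"
    "cent n z y x w' \<longleftrightarrow> cent n x y z w'"
    by (simp_all only: cent_def add_ac)
  show "(cent n x y z w' \<longleftrightarrow> w' = w) \<and>
    (cent n x z y w' \<longleftrightarrow> w' = w) \<and>
    (cent n y x z w' \<longleftrightarrow> w' = w) \<and>
    (cent n y z x w' \<longleftrightarrow> w' = w) \<and>
    (cent n z x y w' \<longleftrightarrow> w' = w) \<and>
    (cent n z y x w' \<longleftrightarrow> w' = w)"
    unfolding 2 by (simp only: 1)
qed

lemma third_char: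
  assumes "third n x y z"
  shows "x \<in> res n \<Longrightarrow> \<forall>x'\<in>res n. third n x' y z \<longleftrightarrow> x' = x"
    and "y \<in> res n \<Longrightarrow> \<forall>y'\<in>res n. third n x y' z \<longleftrightarrow> y' = y"
    and "z \<in> res n \<Longrightarrow> \<forall>z'\<in>res n. third n x y z' \<longleftrightarrow> z' = z"
    and "x \<in> res n \<Longrightarrow> y \<in> res n \<Longrightarrow> x \<noteq> y \<Longrightarrow> \<not> third n y x z"
     apply (metis assms third_1)
    apply (metis assms third_2)
   apply (metis assms third_3)
  apply (metis assms third_swap)
  done

lemma trav_char:
  assumes "trav n x y z w"
  shows "y \<in> res n \<Longrightarrow> \<forall>y'\<in>res n. (trav n x y' z w \<longleftrightarrow> y' = y) \<and> (trav n y' x w z \<longleftrightarrow> y' = y)"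
    and "w \<in> res n \<Longrightarrow> \<forall>w'\<in>res n. (trav n x y z w' \<longleftrightarrow> w' = w) \<and> (trav n y x w' z \<longleftrightarrow> w' = w)"
   apply (metis assms trav_2 trav_flip)
  apply (metis assms trav_4 trav_flip)
  done

lemma eq4_degen:
  assumes "x \<in> res n" "y \<in> res n" "w \<in> res n"
  shows "eq4 n x y x w \<longleftrightarrow> w = y" "eq4 n y x x w \<longleftrightarrow> w = y" "eq4 n x y w x \<longleftrightarrow> w = y" "eq4 n y x w x \<longleftrightarrow> w = y"
proof -
  show 1: "eq4 n x y x w \<longleftrightarrow> w = y"
    using eq4_same[OF _ assms(2,3)] by (auto simp: eq4_def)
  show "eq4 n y x x w \<longleftrightarrow> w = y" "eq4 n x y w x \<longleftrightarrow> w = y" "eq4 n y x w x \<longleftrightarrow> w = y"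
    using 1 eq4_sym(1)[of x y x w] eq4_sym(2)[of x y w x] eq4_sym(1)[of x y w x] by simp_all
qed

lemma third_degen:
  assumes "x \<in> res n" "y \<in> res n"
  shows "third n x y x \<longleftrightarrow> y = x" "third n x y y \<longleftrightarrow> x = y"
  using assms third_13[of x y] third_23[of x y] by (auto simp: third_def)

lemma trav_degen:
  assumes "x \<in> res n" "y \<in> res n"
  shows "trav n z z x y \<longleftrightarrow> x = y" "trav n x y z z \<longleftrightarrow> x = y"
  using assms trav_12[of z x y] trav_34[of x y z] by (auto simp: trav_def)

lemmas degen = eq4_degen third_degen trav_degen

section \<open>Existence and uniqueness for each type of triple\<close>

lemma quad_LL_LL_LL:
  assumes "x \<in> res n" "y \<in> res n" "z \<in> res n" "distinct [x, y, z]"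
  shows "\<exists>!B. B \<in> quad n \<and> {((L, L), x), ((L, L), y), ((L, L), z)} \<subseteq> B"
    (is "\<exists>!B. _ \<and> ?T \<subseteq> B")
proof -
    obtain w where w: "w \<in> res n" "cent n x y z w"
      using res_solve[of 3 "x + y + z"] by (auto simp: cent_def algebra_simps)
  show ?thesis
    proof (rule quad_ex1I[of "((L, R), w)"])
      show "insert ((L, R), w) ?T \<in> quad n"
        using quad.A[of x n y z w L L] assms w by (auto simp: insert_commute)
      show "((L, R), w) \<notin> ?T"
        using assms w by auto
    \<comment> \<open>Most block shapes are refuted by their copies alone. In the others the
      coordinates get identified by substitution, and the relations are decided by
      \<open>cent_char4\<close> and \<open>degen\<close>. The same method closes all types
      below.\<close>
    qed (use assms w cent_char4[OF w(2,1)] in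
      \<open>(simp add: degen; (elim disjE conjE; hypsubst_thin?; simp add: degen)?)+\<close>)
qed

lemma quad_RL_RL_RL:
  assumes "x \<in> res n" "y \<in> res n" "z \<in> res n" "distinct [x, y, z]"
  shows "\<exists>!B. B \<in> quad n \<and> {((R, L), x), ((R, L), y), ((R, L), z)} \<subseteq> B"
    (is "\<exists>!B. _ \<and> ?T \<subseteq> B")
proof -
    obtain w where w: "w \<in> res n" "cent n x y z w"
      using res_solve[of 3 "x + y + z"] by (auto simp: cent_def algebra_simps)
  show ?thesis
    proof (rule quad_ex1I[of "((R, R), w)"])
      show "insert ((R, R), w) ?T \<in> quad n"
        using quad.A[of x n y z w R L] assms w by (auto simp: insert_commute)
      show "((R, R), w) \<notin> ?T"
        using assms w by auto
    qed (use assms w cent_char4[OF w(2,1)] in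
      \<open>(simp add: degen; (elim disjE conjE; hypsubst_thin?; simp add: degen)?)+\<close>)
qed

text \<open>Rule \<open>A\<close> completes the triple by 3t - x - y in the copy of x and y. This is
  one of the given cells exactly when t divides the segment from x to y, or from y to x, in the
  ratio 1 : 2; then \<open>T0\<close> supplies a cell on the other side instead.\<close>

lemma quad_LL_LL_LR:
  assumes "x \<in> res n" "y \<in> res n" "t \<in> res n" "x \<noteq> y"
  shows "\<exists>!B. B \<in> quad n \<and> {((L, L), x), ((L, L), y), ((L, R), t)} \<subseteq> B"
    (is "\<exists>!B. _ \<and> ?T \<subseteq> B")
proof -
  consider "third n x y t" | "third n y x t" | "\<not> third n x y t" "\<not> third n y x t"
    by blast
  then show ?thesis
  proof cases
    case 1
    show ?thesis
    proof (rule quad_ex1I[of "((R, L), x)"])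
      show "insert ((R, L), x) ?T \<in> quad n"
        using quad.T0[of x n y t L] assms 1 by (auto simp: insert_commute)
      show "((R, L), x) \<notin> ?T"
        using assms 1 by auto
    qed (use assms 1 third_char(4)[OF 1 assms(1,2,4)] cent_char[OF iffD2[OF cent_third(1) 1] assms(1)] in
      \<open>(simp add: degen; (elim disjE conjE; hypsubst_thin?; simp add: degen)?)+\<close>)
  next
    case 2
    show ?thesis
    proof (rule quad_ex1I[of "((R, L), y)"])
      show "insert ((R, L), y) ?T \<in> quad n"
        using quad.T0[of y n x t L] assms 2 by (auto simp: insert_commute)
      show "((R, L), y) \<notin> ?T"
        using assms 2 by auto
    qed (use assms 2 third_char(4)[OF 2 assms(2,1) assms(4)[symmetric]] cent_char[OF iffD2[OF cent_third(2) 2] assms(2)] in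
      \<open>(simp add: degen; (elim disjE conjE; hypsubst_thin?; simp add: degen)?)+\<close>)
  next
    case 3
    obtain w where w: "w \<in> res n" "cent n x y w t"
      using res_solve'[of 1 "3 * t - x - y"] by (auto simp: cent_def algebra_simps)
    have w': "w \<noteq> x" "w \<noteq> y"
      using 3 w(2) cent_third cent_sym by metis+
    show ?thesis
    proof (rule quad_ex1I[of "((L, L), w)"])
      show "insert ((L, L), w) ?T \<in> quad n"
        using quad.A[of x n y w t L L] assms w w' 3 by (auto simp: insert_commute)
      show "((L, L), w) \<notin> ?T"
        using assms w w' 3 by auto
    qed (use assms w w' 3 cent_char[OF w(2,1)] in
      \<open>(simp add: degen; (elim disjE conjE; hypsubst_thin?; simp add: degen)?)+\<close>)
  qed
qed

text \<open>As on side L, except that \<open>T1\<close> puts the fourth cell at the endpoint farther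
  from t, where \<open>T0\<close> takes the nearer one. This asymmetry mirrors the unequal weights
  of \<open>trav\<close>.\<close>

lemma quad_RL_RL_RR:
  assumes "x \<in> res n" "y \<in> res n" "t \<in> res n" "x \<noteq> y"
  shows "\<exists>!B. B \<in> quad n \<and> {((R, L), x), ((R, L), y), ((R, R), t)} \<subseteq> B"
    (is "\<exists>!B. _ \<and> ?T \<subseteq> B")
proof -
  consider "third n x y t" | "third n y x t" | "\<not> third n x y t" "\<not> third n y x t"
    by blast
  then show ?thesis
  proof cases
    case 1
    show ?thesis
    proof (rule quad_ex1I[of "((L, L), y)"])
      show "insert ((L, L), y) ?T \<in> quad n"
        using quad.T1[of x n y t L] assms 1 by (auto simp: insert_commute)
      show "((L, L), y) \<notin> ?T"
        using assms 1 by auto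
    qed (use assms 1 third_char(4)[OF 1 assms(1,2,4)] cent_char[OF iffD2[OF cent_third(1) 1] assms(1)] in
      \<open>(simp add: degen; (elim disjE conjE; hypsubst_thin?; simp add: degen)?)+\<close>)
  next
    case 2
    show ?thesis
    proof (rule quad_ex1I[of "((L, L), x)"])
      show "insert ((L, L), x) ?T \<in> quad n"
        using quad.T1[of y n x t L] assms 2 by (auto simp: insert_commute)
      show "((L, L), x) \<notin> ?T"
        using assms 2 by auto
    qed (use assms 2 third_char(4)[OF 2 assms(2,1) assms(4)[symmetric]] cent_char[OF iffD2[OF cent_third(2) 2] assms(2)] in
      \<open>(simp add: degen; (elim disjE conjE; hypsubst_thin?; simp add: degen)?)+\<close>)
  next
    case 3
    obtain w where w: "w \<in> res n" "cent n x y w t"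
      using res_solve'[of 1 "3 * t - x - y"] by (auto simp: cent_def algebra_simps)
    have w': "w \<noteq> x" "w \<noteq> y"
      using 3 w(2) cent_third cent_sym by metis+
    show ?thesis
    proof (rule quad_ex1I[of "((R, L), w)"])
      show "insert ((R, L), w) ?T \<in> quad n"
        using quad.A[of x n y w t R L] assms w w' 3 by (auto simp: insert_commute)
      show "((R, L), w) \<notin> ?T"
        using assms w w' 3 by auto
    qed (use assms w w' 3 cent_char[OF w(2,1)] in
      \<open>(simp add: degen; (elim disjE conjE; hypsubst_thin?; simp add: degen)?)+\<close>)
  qed
qed

text \<open>\<open>P\<close> fails in two ways. If t is x or y, its inequalities exclude it, and
  \<open>T0\<close> applies with the third nearer to t. If t is the midpoint, the computed cell
  would be t itself, and \<open>M\<close> moves it to the remaining copy.\<close>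

lemma quad_LL_LL_RL:
  assumes "x \<in> res n" "y \<in> res n" "t \<in> res n" "x \<noteq> y"
  shows "\<exists>!B. B \<in> quad n \<and> {((L, L), x), ((L, L), y), ((R, L), t)} \<subseteq> B"
    (is "\<exists>!B. _ \<and> ?T \<subseteq> B")
proof -
  consider "t = x" | "t = y" | "t \<noteq> x" "t \<noteq> y" "eq4 n x y t t" | "t \<noteq> x" "t \<noteq> y" "\<not> eq4 n x y t t"
    by blast
  then show ?thesis
  proof cases
    case 1
    obtain a where a: "a \<in> res n" "third n x y a"
      using res_solve[of 3 "2 * x + y"] by (auto simp: third_def algebra_simps)
    show ?thesis
    proof (rule quad_ex1I[of "((L, R), a)"])
      show "insert ((L, R), a) ?T \<in> quad n"
        using quad.T0[of x n y a L] assms a 1 by (auto simp: insert_commute)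
      show "((L, R), a) \<notin> ?T"
        using assms a 1 by auto
    qed (use assms a 1 third_char(3)[OF a(2,1)] in
      \<open>(simp add: degen; (elim disjE conjE; hypsubst_thin?; simp add: degen)?)+\<close>)
  next
    case 2
    obtain a where a: "a \<in> res n" "third n y x a"
      using res_solve[of 3 "2 * y + x"] by (auto simp: third_def algebra_simps)
    show ?thesis
    proof (rule quad_ex1I[of "((L, R), a)"])
      show "insert ((L, R), a) ?T \<in> quad n"
        using quad.T0[of y n x a L] assms a 2 by (auto simp: insert_commute)
      show "((L, R), a) \<notin> ?T"
        using assms a 2 by auto
    qed (use assms a 2 third_char(3)[OF a(2,1)] in
      \<open>(simp add: degen; (elim disjE conjE; hypsubst_thin?; simp add: degen)?)+\<close>)
  next
    case 3
    show ?thesis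
    proof (rule quad_ex1I[of "((R, R), t)"])
      show "insert ((R, R), t) ?T \<in> quad n"
        using quad.M[of x n y t L L] assms 3 by (auto simp: insert_commute)
      show "((R, R), t) \<notin> ?T"
        using assms 3 by auto
    qed (use assms 3 eq4_char[OF 3(3) assms(3)] in
      \<open>(simp add: degen; (elim disjE conjE; hypsubst_thin?; simp add: degen)?)+\<close>)
  next
    case 4
    obtain w where w: "w \<in> res n" "eq4 n x y t w"
      using res_solve[of 1 "x + y - t"] by (auto simp: eq4_def algebra_simps)
    have w': "w \<noteq> x" "w \<noteq> y"
      using eq4_distinct[OF w(2)] assms w(1) 4 by blast+
    show ?thesis
    proof (rule quad_ex1I[of "((R, L), w)"])
      show "insert ((R, L), w) ?T \<in> quad n"
        using quad.P[of x n y t w L] w' assms w w' 4 by (auto simp: insert_commute eq4_sym)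
      show "((R, L), w) \<notin> ?T"
        using assms w w' 4 by auto
    qed (use assms w w' 4 eq4_char[OF w(2,1)] in
      \<open>(simp add: degen; (elim disjE conjE; hypsubst_thin?; simp add: degen)?)+\<close>)
  qed
qed

text \<open>Rule \<open>B\<close> allows coordinates of the two sides to coincide, so the midpoint
  is the only exception.\<close>

lemma quad_LL_LL_RR:
  assumes "x \<in> res n" "y \<in> res n" "t \<in> res n" "x \<noteq> y"
  shows "\<exists>!B. B \<in> quad n \<and> {((L, L), x), ((L, L), y), ((R, R), t)} \<subseteq> B"
    (is "\<exists>!B. _ \<and> ?T \<subseteq> B")
proof -
  consider "eq4 n x y t t" | "\<not> eq4 n x y t t"
    by blast
  then show ?thesis
  proof cases
    case 1
    show ?thesis
    proof (rule quad_ex1I[of "((R, L), t)"])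
      show "insert ((R, L), t) ?T \<in> quad n"
        using quad.M[of x n y t L L] assms 1 by (auto simp: insert_commute)
      show "((R, L), t) \<notin> ?T"
        using assms 1 by auto
    qed (use assms 1 eq4_char[OF 1 assms(3)] in
      \<open>(simp add: degen; (elim disjE conjE; hypsubst_thin?; simp add: degen)?)+\<close>)
  next
    case 2
    obtain w where w: "w \<in> res n" "eq4 n x y t w"
      using res_solve[of 1 "x + y - t"] by (auto simp: eq4_def algebra_simps)
    show ?thesis
    proof (rule quad_ex1I[of "((R, R), w)"])
      show "insert ((R, R), w) ?T \<in> quad n"
        using quad.B[of x n y t w L] assms w 2 by (auto simp: insert_commute eq4_sym)
      show "((R, R), w) \<notin> ?T"
        using assms w 2 by auto
    qed (use assms w 2 eq4_char[OF w(2,1)] in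
      \<open>(simp add: degen; (elim disjE conjE; hypsubst_thin?; simp add: degen)?)+\<close>)
  qed
qed

lemma quad_RL_RL_LL:
  assumes "x \<in> res n" "y \<in> res n" "t \<in> res n" "x \<noteq> y"
  shows "\<exists>!B. B \<in> quad n \<and> {((R, L), x), ((R, L), y), ((L, L), t)} \<subseteq> B"
    (is "\<exists>!B. _ \<and> ?T \<subseteq> B")
proof -
  consider "t = x" | "t = y" | "t \<noteq> x" "t \<noteq> y" "eq4 n x y t t" | "t \<noteq> x" "t \<noteq> y" "\<not> eq4 n x y t t"
    by blast
  then show ?thesis
  proof cases
    case 1
    \<comment> \<open>\<open>T1\<close> repeats its second endpoint on side L, so
      \<open>t = x\<close> requires the endpoints in reversed roles.\<close>
    obtain a where a: "a \<in> res n" "third n y x a"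
      using res_solve[of 3 "2 * y + x"] by (auto simp: third_def algebra_simps)
    show ?thesis
    proof (rule quad_ex1I[of "((R, R), a)"])
      show "insert ((R, R), a) ?T \<in> quad n"
        using quad.T1[of y n x a L] assms a 1 by (auto simp: insert_commute)
      show "((R, R), a) \<notin> ?T"
        using assms a 1 by auto
    qed (use assms a 1 third_char(3)[OF a(2,1)] in
      \<open>(simp add: degen; (elim disjE conjE; hypsubst_thin?; simp add: degen)?)+\<close>)
  next
    case 2
    obtain a where a: "a \<in> res n" "third n x y a"
      using res_solve[of 3 "2 * x + y"] by (auto simp: third_def algebra_simps)
    show ?thesis
    proof (rule quad_ex1I[of "((R, R), a)"])
      show "insert ((R, R), a) ?T \<in> quad n"
        using quad.T1[of x n y a L] assms a 2 by (auto simp: insert_commute)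
      show "((R, R), a) \<notin> ?T"
        using assms a 2 by auto
    qed (use assms a 2 third_char(3)[OF a(2,1)] in
      \<open>(simp add: degen; (elim disjE conjE; hypsubst_thin?; simp add: degen)?)+\<close>)
  next
    case 3
    show ?thesis
    proof (rule quad_ex1I[of "((L, R), t)"])
      show "insert ((L, R), t) ?T \<in> quad n"
        using quad.M[of x n y t R L] assms 3 by (auto simp: insert_commute)
      show "((L, R), t) \<notin> ?T"
        using assms 3 by auto
    qed (use assms 3 eq4_char[OF 3(3) assms(3)] in
      \<open>(simp add: degen; (elim disjE conjE; hypsubst_thin?; simp add: degen)?)+\<close>)
  next
    case 4
    obtain w where w: "w \<in> res n" "eq4 n x y t w"
      using res_solve[of 1 "x + y - t"] by (auto simp: eq4_def algebra_simps)
    have w': "w \<noteq> x" "w \<noteq> y"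
      using eq4_distinct[OF w(2)] assms w(1) 4 by blast+
    show ?thesis
    proof (rule quad_ex1I[of "((L, L), w)"])
      show "insert ((L, L), w) ?T \<in> quad n"
        using quad.P[of t n w x y L] w' assms w w' 4 by (auto simp: insert_commute eq4_sym)
      show "((L, L), w) \<notin> ?T"
        using assms w w' 4 by auto
    qed (use assms w w' 4 eq4_char[OF w(2,1)] in
      \<open>(simp add: degen; (elim disjE conjE; hypsubst_thin?; simp add: degen)?)+\<close>)
  qed
qed

lemma quad_RL_RL_LR:
  assumes "x \<in> res n" "y \<in> res n" "t \<in> res n" "x \<noteq> y"
  shows "\<exists>!B. B \<in> quad n \<and> {((R, L), x), ((R, L), y), ((L, R), t)} \<subseteq> B"
    (is "\<exists>!B. _ \<and> ?T \<subseteq> B")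
proof -
  consider "eq4 n x y t t" | "\<not> eq4 n x y t t"
    by blast
  then show ?thesis
  proof cases
    case 1
    show ?thesis
    proof (rule quad_ex1I[of "((L, L), t)"])
      show "insert ((L, L), t) ?T \<in> quad n"
        using quad.M[of x n y t R L] assms 1 by (auto simp: insert_commute)
      show "((L, L), t) \<notin> ?T"
        using assms 1 by auto
    qed (use assms 1 eq4_char[OF 1 assms(3)] in
      \<open>(simp add: degen; (elim disjE conjE; hypsubst_thin?; simp add: degen)?)+\<close>)
  next
    case 2
    obtain w where w: "w \<in> res n" "eq4 n x y t w"
      using res_solve[of 1 "x + y - t"] by (auto simp: eq4_def algebra_simps)
    show ?thesis
    proof (rule quad_ex1I[of "((L, R), w)"])
      show "insert ((L, R), w) ?T \<in> quad n"
        using quad.B[of t n w x y "R"] assms w 2 by (auto simp: insert_commute eq4_sym)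
      show "((L, R), w) \<notin> ?T"
        using assms w 2 by auto
    qed (use assms w 2 eq4_char[OF w(2,1)] in
      \<open>(simp add: degen; (elim disjE conjE; hypsubst_thin?; simp add: degen)?)+\<close>)
  qed
qed

text \<open>The generic block is \<open>C\<close> with w = z + (x - y)/2. The exceptions are
  \<open>x = y\<close>, served by \<open>D\<close> or \<open>M\<close>; \<open>x = z\<close>, where
  \<open>T0\<close> adds a second cell to the copy of x; and w = y, which means
  \<open>third n z x y\<close> and is again served by \<open>T0\<close>, now with z as the added
  coordinate.\<close>

lemma quad_LL_LR_RL:
  assumes "x \<in> res n" "y \<in> res n" "z \<in> res n"
  shows "\<exists>!B. B \<in> quad n \<and> {((L, L), x), ((L, R), y), ((R, L), z)} \<subseteq> B"
    (is "\<exists>!B. _ \<and> ?T \<subseteq> B")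
proof -
  consider "x = y" "y = z" | "x = y" "x \<noteq> z" | "x \<noteq> y" "x = z" | "x \<noteq> z" "third n z x y" | "x \<noteq> y" "x \<noteq> z" "\<not> third n z x y"
    by blast
  then show ?thesis
  proof cases
    case 1
    show ?thesis
    proof (rule quad_ex1I[of "((R, R), x)"])
      show "insert ((R, R), x) ?T \<in> quad n"
        using quad.D[of x n L] assms 1 by (auto simp: insert_commute)
      show "((R, R), x) \<notin> ?T"
        using assms 1 by auto
    qed (use assms 1  in
      \<open>(simp add: degen; (elim disjE conjE; hypsubst_thin?; simp add: degen)?)+\<close>)
  next
    case 2
    obtain w where w: "w \<in> res n" "eq4 n z w x x"
      using res_solve'[of 1 "2 * x - z"] by (auto simp: eq4_def algebra_simps)
    have w': "w \<noteq> z"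
      using eq4_double[of z x] w assms 2 by blast
    show ?thesis
    proof (rule quad_ex1I[of "((R, L), w)"])
      show "insert ((R, L), w) ?T \<in> quad n"
        using quad.M[of z n w x R L] assms w w' 2 by (auto simp: insert_commute)
      show "((R, L), w) \<notin> ?T"
        using assms w w' 2 by auto
    qed (use assms w w' 2 eq4_char[OF iffD2[OF eq4_sym(3) w(2)] w(1)] in
      \<open>(simp add: degen; (elim disjE conjE; hypsubst_thin?; simp add: degen)?)+\<close>)
  next
    case 3
    obtain w where w: "w \<in> res n" "third n x w y"
      using res_solve'[of 1 "3 * y - 2 * x"] by (auto simp: third_def algebra_simps)
    have w': "w \<noteq> x"
      using third_double[of x y] w assms 3 by blast
    show ?thesis
    proof (rule quad_ex1I[of "((L, L), w)"])
      show "insert ((L, L), w) ?T \<in> quad n"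
        using quad.T0[of x n w y L] assms w w' 3 by (auto simp: insert_commute)
      show "((L, L), w) \<notin> ?T"
        using assms w w' 3 by auto
    qed (use assms w w' 3 third_char(2)[OF w(2,1)] in
      \<open>(simp add: degen; (elim disjE conjE; hypsubst_thin?; simp add: degen)?)+\<close>)
  next
    case 4
    show ?thesis
    proof (rule quad_ex1I[of "((L, L), z)"])
      show "insert ((L, L), z) ?T \<in> quad n"
        using quad.T0[of z n x y L] assms 4 by (auto simp: insert_commute)
      show "((L, L), z) \<notin> ?T"
        using assms 4 by auto
    qed (use assms 4 trav_char(2)[OF iffD2[OF trav_third(1) 4(2)] assms(2)] third_char(4)[OF 4(2) assms(3,1) 4(1)[symmetric]] in
      \<open>(simp add: degen; (elim disjE conjE; hypsubst_thin?; simp add: degen)?)+\<close>)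
  next
    case 5
    obtain w where w: "w \<in> res n" "trav n x y z w"
      using res_solve[of 2 "x - y + 2 * z"] by (auto simp: trav_def algebra_simps)
    have w': "w \<noteq> y"
      using w(2) 5(3) trav_third(1) by metis
    show ?thesis
    proof (rule quad_ex1I[of "((R, R), w)"])
      show "insert ((R, R), w) ?T \<in> quad n"
        using quad.C[of x n y z w L] assms w w' 5 by (auto simp: insert_commute)
      show "((R, R), w) \<notin> ?T"
        using assms w w' 5 by auto
    qed (use assms w w' 5 trav_char(2)[OF w(2,1)] in
      \<open>(simp add: degen; (elim disjE conjE; hypsubst_thin?; simp add: degen)?)+\<close>)
  qed
qed

text \<open>Here \<open>C\<close> gives y = x + 2(z - w). It degenerates for \<open>z = w\<close>,
  which is the same as y = x, for \<open>x = z\<close>, and for y = w; the last two belong to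
  \<open>T1\<close>.\<close>

lemma quad_LL_RL_RR:
  assumes "x \<in> res n" "z \<in> res n" "w \<in> res n"
  shows "\<exists>!B. B \<in> quad n \<and> {((L, L), x), ((R, L), z), ((R, R), w)} \<subseteq> B"
    (is "\<exists>!B. _ \<and> ?T \<subseteq> B")
proof -
  consider "x = z" "z = w" | "z = w" "x \<noteq> z" | "x = z" "z \<noteq> w" | "x \<noteq> z" "third n z x w" | "x \<noteq> z" "z \<noteq> w" "\<not> third n z x w"
    by blast
  then show ?thesis
  proof cases
    case 1
    show ?thesis
    proof (rule quad_ex1I[of "((L, R), x)"])
      show "insert ((L, R), x) ?T \<in> quad n"
        using quad.D[of x n L] assms 1 by (auto simp: insert_commute)
      show "((L, R), x) \<notin> ?T"
        using assms 1 by auto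
    qed (use assms 1  in
      \<open>(simp add: degen; (elim disjE conjE; hypsubst_thin?; simp add: degen)?)+\<close>)
  next
    case 2
    obtain y where y: "y \<in> res n" "eq4 n x y z z"
      using res_solve'[of 1 "2 * z - x"] by (auto simp: eq4_def algebra_simps)
    have y': "y \<noteq> x"
      using eq4_double[of x z] y assms 2 by blast
    show ?thesis
    proof (rule quad_ex1I[of "((L, L), y)"])
      show "insert ((L, L), y) ?T \<in> quad n"
        using quad.M[of x n y z L L] assms y y' 2 by (auto simp: insert_commute)
      show "((L, L), y) \<notin> ?T"
        using assms y y' 2 by auto
    qed (use assms y y' 2 eq4_char[OF iffD2[OF eq4_sym(3) y(2)] y(1)] in
      \<open>(simp add: degen; (elim disjE conjE; hypsubst_thin?; simp add: degen)?)+\<close>)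
  next
    case 3
    obtain y where y: "y \<in> res n" "third n y x w"
      using res_solve'[of 2 "3 * w - x"] by (auto simp: third_def algebra_simps)
    have y': "y \<noteq> x"
      using third_double[of x w] y assms 3 by blast
    show ?thesis
    proof (rule quad_ex1I[of "((R, L), y)"])
      show "insert ((R, L), y) ?T \<in> quad n"
        using quad.T1[of y n x w L] assms y y' 3 by (auto simp: insert_commute)
      show "((R, L), y) \<notin> ?T"
        using assms y y' 3 by auto
    qed (use assms y y' 3 third_char(1)[OF y(2,1)] in
      \<open>(simp add: degen; (elim disjE conjE; hypsubst_thin?; simp add: degen)?)+\<close>)
  next
    case 4
    show ?thesis
    proof (rule quad_ex1I[of "((R, L), x)"])
      show "insert ((R, L), x) ?T \<in> quad n"
        using quad.T1[of z n x w L] assms 4 by (auto simp: insert_commute)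
      show "((R, L), x) \<notin> ?T"
        using assms 4 by auto
    qed (use assms 4 trav_char(1)[OF iffD2[OF trav_third(1) 4(2)] assms(3)] third_char(4)[OF 4(2) assms(2,1) 4(1)[symmetric]] in
      \<open>(simp add: degen; (elim disjE conjE; hypsubst_thin?; simp add: degen)?)+\<close>)
  next
    case 5
    obtain y where y: "y \<in> res n" "trav n x y z w"
      using res_solve[of 1 "x + 2 * z - 2 * w"] by (auto simp: trav_def algebra_simps)
    have y': "y \<noteq> x" "y \<noteq> w"
      using y(2) 5(2,3) trav_12 trav_third(1) assms by metis+
    show ?thesis
    proof (rule quad_ex1I[of "((L, R), y)"])
      show "insert ((L, R), y) ?T \<in> quad n"
        using quad.C[of x n y z w L] assms y y' 5 by (auto simp: insert_commute)
      show "((L, R), y) \<notin> ?T"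
        using assms y y' 5 by auto
    qed (use assms y y' 5 trav_char(1)[OF y(2,1)] in
      \<open>(simp add: degen; (elim disjE conjE; hypsubst_thin?; simp add: degen)?)+\<close>)
  qed
qed

end

section \<open>All triples by symmetry\<close>

fun rank :: "cell \<Rightarrow> nat" where
  "rank ((L, L), _) = 0"
| "rank ((L, R), _) = 1"
| "rank ((R, L), _) = 2"
| "rank ((R, R), _) = 3"

text \<open>Three cells can be spread over the four copies in 20 ways, regardless of order, and
  \<open>flip\<close> pairs these into the ten treated above. Exchanging the first components
  instead would not help: \<open>trav\<close> weights the sides differently.\<close>

definition flip :: "cell \<Rightarrow> cell" where
  "flip = (\<lambda>((c, i), x). ((c, opp i), x))"

lemma flip_flip [simp]: "flip (flip q) = q"
  by (auto simp: flip_def split: prod.splits)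

lemma finite_cells: "finite (UNIV \<times> res n :: cell set)"
proof (rule finite_cartesian_product)
  have "(UNIV :: side set) = {L, R}" using side.exhaust by auto
  then show "finite (UNIV :: (side \<times> side) set)"
    by (metis UNIV_Times_UNIV finite.emptyI finite_cartesian_product finite_insert)
qed simp

context coprime_six begin

lemma quad_flip:
  assumes "B \<in> quad n"
  shows "flip ` B \<in> quad n"
  using assms
proof cases
  case (A x y z w c i)
  then show ?thesis using quad.A[of x n y z w c "opp i"] by (simp add: flip_def)
next
  case (P x y z w i)
  then show ?thesis using quad.P[of x n y z w "opp i"] by (simp add: flip_def)
next
  case (B x y z w i)
  then show ?thesis using quad.B[of x n y z w "opp i"] by (simp add: flip_def)
next
  case (M x y z c i)
  then show ?thesis using quad.M[of x n y z c "opp i"] by (simp add: flip_def)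
next
  case (T0 x y z i)
  then show ?thesis using quad.T0[of x n y z "opp i"] by (simp add: flip_def)
next
  case (T1 x y z i)
  then show ?thesis using quad.T1[of x n y z "opp i"] by (simp add: flip_def)
next
  case (C x y z w i)
  then show ?thesis using quad.C[of x n y z w "opp i"] by (simp add: flip_def)
next
  case (D x i)
  then show ?thesis using quad.D[of x n "opp i"] by (simp add: flip_def)
qed

lemma quad_ex1_flip:
  assumes "\<exists>!B. B \<in> quad n \<and> T \<subseteq> B"
  shows "\<exists>!B. B \<in> quad n \<and> flip ` T \<subseteq> B"
proof -
  from assms obtain B where B: "B \<in> quad n" "T \<subseteq> B" "\<And>B'. B' \<in> quad n \<Longrightarrow> T \<subseteq> B' \<Longrightarrow> B' = B"
    by (elim ex1E conjE) blast
  have ff: "flip ` flip ` A = A" for A by (simp add: image_image)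
  show ?thesis
  proof (rule ex1I[of _ "flip ` B"])
    show "flip ` B \<in> quad n \<and> flip ` T \<subseteq> flip ` B" using quad_flip B(1,2) by blast
    fix B' assume B': "B' \<in> quad n \<and> flip ` T \<subseteq> B'"
    then have "flip ` flip ` T \<subseteq> flip ` B'" by (intro image_mono) simp
    then have "flip ` B' = B" using B(3)[OF quad_flip] B' unfolding ff by blast
    then show "B' = flip ` B" using ff by metis
  qed
qed

lemma quad_sorted:
  assumes "rank a \<le> rank b" "rank b \<le> rank c" "distinct [a, b, c]" "{a, b, c} \<subseteq> UNIV \<times> res n"
  shows "\<exists>!B. B \<in> quad n \<and> {a, b, c} \<subseteq> B"
proof -
  obtain ca ia x cb ib y cc ic z where eq: "a = ((ca, ia), x)" "b = ((cb, ib), y)" "c = ((cc, ic), z)"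
    by (metis surj_pair)
  have res: "x \<in> res n" "y \<in> res n" "z \<in> res n" using assms(4) by (auto simp: eq)
  note left = quad_LL_LL_LL[OF res] quad_RL_RL_RL[OF res] quad_LL_LL_LR[OF res(1,2,3)] quad_RL_RL_RR[OF res(1,2,3)]
    quad_LL_LL_RL[OF res(1,2,3)] quad_RL_RL_LL[OF res(2,3,1)] quad_LL_LL_RR[OF res(1,2,3)] quad_RL_RL_LR[OF res(2,3,1)]
    quad_LL_LR_RL[OF res(1,2,3)] quad_LL_RL_RR[OF res(1,2,3)]
  \<comment> \<open>After \<open>flip\<close> the pair of cells in a common copy may come last in
    the sorted triple, hence the permuted instances.\<close>
  note right = quad_LL_LL_LL[OF res, THEN quad_ex1_flip] quad_RL_RL_RL[OF res, THEN quad_ex1_flip]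
    quad_LL_LL_LR[OF res(2,3,1), THEN quad_ex1_flip] quad_RL_RL_RR[OF res(2,3,1), THEN quad_ex1_flip]
    quad_LL_LL_RL[OF res(1,2,3), THEN quad_ex1_flip] quad_RL_RL_LL[OF res(2,3,1), THEN quad_ex1_flip]
    quad_LL_LL_RR[OF res(1,2,3), THEN quad_ex1_flip] quad_RL_RL_LR[OF res(2,3,1), THEN quad_ex1_flip]
    quad_LL_LR_RL[OF res(2,1,3), THEN quad_ex1_flip] quad_LL_RL_RR[OF res(1,3,2), THEN quad_ex1_flip]
  show ?thesis
    using assms(1-3) left right unfolding eq
    by (cases ca; cases ia; cases cb; cases ib; cases cc; cases ic)
       (simp_all add: insert_commute flip_def)
qed

lemma sqs_quad: "sqs (UNIV \<times> res n) (quad n)"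
proof -
  have "\<exists>!B. B \<in> quad n \<and> {a, b, c} \<subseteq> B"
    if abc: "a \<in> UNIV \<times> res n" "b \<in> UNIV \<times> res n" "c \<in> UNIV \<times> res n" "distinct [a, b, c]" for a b c
  proof -
    have Q: ?thesis if "{x, y, z} = {a, b, c}" "distinct [x, y, z]" "rank x \<le> rank y" "rank y \<le> rank z" for x y z
      using quad_sorted[OF that(3,4,2)] abc(1-3) unfolding that(1) by simp
    consider "rank a \<le> rank b" "rank b \<le> rank c" | "rank a \<le> rank c" "rank c \<le> rank b"
      | "rank b \<le> rank a" "rank a \<le> rank c" | "rank b \<le> rank c" "rank c \<le> rank a"
      | "rank c \<le> rank a" "rank a \<le> rank b" | "rank c \<le> rank b" "rank b \<le> rank a"
      by linarith
    then show ?thesis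
    proof cases
      case 1 then show ?thesis using abc(4) by (intro Q[of a b c]) auto
    next
      case 2 then show ?thesis using abc(4) by (intro Q[of a c b]) auto
    next
      case 3 then show ?thesis using abc(4) by (intro Q[of b a c]) auto
    next
      case 4 then show ?thesis using abc(4) by (intro Q[of b c a]) auto
    next
      case 5 then show ?thesis using abc(4) by (intro Q[of c a b]) auto
    next
      case 6 then show ?thesis using abc(4) by (intro Q[of c b a]) auto
    qed
  qed
  then show ?thesis
    unfolding sqs_def using card_quad finite_cells by simp
qed

section \<open>Translations\<close>

lemma translate_eq:
  "x \<in> res n \<Longrightarrow> y \<in> res n \<Longrightarrow> (x + s) mod n = (y + s) mod n \<longleftrightarrow> x = y"
  by (metis add_diff_cancel_right mod_eq_dvd_iff mod_pos_pos_trivial res_def atLeastLessThan_iff)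

lemma translate_res: "(x + s) mod n \<in> res n"
  using n by (simp add: res_def)

lemma translate_cong: "[(x + s) mod n = x + s] (mod n)"
  by simp

lemma translate_rel:
  "eq4 n ((x + s) mod n) ((y + s) mod n) ((z + s) mod n) ((w + s) mod n) \<longleftrightarrow> eq4 n x y z w"
  "third n ((x + s) mod n) ((y + s) mod n) ((z + s) mod n) \<longleftrightarrow> third n x y z"
  "cent n ((x + s) mod n) ((y + s) mod n) ((z + s) mod n) ((w + s) mod n) \<longleftrightarrow> cent n x y z w"
  "trav n ((x + s) mod n) ((y + s) mod n) ((z + s) mod n) ((w + s) mod n) \<longleftrightarrow> trav n x y z w"
proof -
  note c = translate_cong cong_refl cong_mult cong_add cong_diff
  have "[(x + s) mod n + (y + s) mod n - (z + s) mod n - (w + s) mod n =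
      (x + s) + (y + s) - (z + s) - (w + s)] (mod n)" by (intro c)
  from cong_dvd_iff[OF this] show "eq4 n ((x + s) mod n) ((y + s) mod n) ((z + s) mod n) ((w + s) mod n) \<longleftrightarrow> eq4 n x y z w"
    by (simp add: eq4_def algebra_simps)
  have "[2 * ((x + s) mod n) + (y + s) mod n - 3 * ((z + s) mod n) =
      2 * (x + s) + (y + s) - 3 * (z + s)] (mod n)" by (intro c)
  from cong_dvd_iff[OF this] show "third n ((x + s) mod n) ((y + s) mod n) ((z + s) mod n) \<longleftrightarrow> third n x y z"
    by (simp add: third_def algebra_simps)
  have "[(x + s) mod n + (y + s) mod n + (z + s) mod n - 3 * ((w + s) mod n) =
      (x + s) + (y + s) + (z + s) - 3 * (w + s)] (mod n)" by (intro c)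
  from cong_dvd_iff[OF this] show "cent n ((x + s) mod n) ((y + s) mod n) ((z + s) mod n) ((w + s) mod n) \<longleftrightarrow> cent n x y z w"
    by (simp add: cent_def algebra_simps)
  have "[(x + s) mod n - (y + s) mod n + 2 * ((z + s) mod n) - 2 * ((w + s) mod n) =
      (x + s) - (y + s) + 2 * (z + s) - 2 * (w + s)] (mod n)" by (intro c)
  from cong_dvd_iff[OF this] show "trav n ((x + s) mod n) ((y + s) mod n) ((z + s) mod n) ((w + s) mod n) \<longleftrightarrow> trav n x y z w"
    by (simp add: trav_def algebra_simps)
qed

lemma quad_translate:
  assumes "B \<in> quad n"
  shows "(\<lambda>(f, x). (f, (x + s) mod n)) ` B \<in> quad n"
  using assms
  by cases (simp_all add: quad.intros translate_res translate_eq translate_rel)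

end

text \<open>Each copy of Z/kp is cut into k rows, the cosets of the subgroup generated by k, which
  has order p. Translation by k then becomes the column shift by 1. Nothing like coprimality of k
  and p is involved.\<close>

definition place :: "nat \<Rightarrow> cell \<Rightarrow> nat \<times> nat" where
  "place k = (\<lambda>((c, i), x). ((2 * of_bool (c = R) + of_bool (i = R)) * k + nat x mod k, nat x div k))"

lemma bij_place:
  assumes "k > 0"
  shows "bij_betw (place k) (UNIV \<times> res (int (k * p))) ({0..<4 * k} \<times> {0..<p})"
proof -
  define f where "f = (\<lambda>(c, i). 2 * of_bool (c = R) + of_bool (i = R) :: nat)"
  have f4: "f s < 4" for s by (cases s) (auto simp: f_def)
  have f_inj: "s = t" if "f s = f t" for s t
  proof (cases s, cases t)
    fix a b c d assume "s = (a, b)" "t = (c, d)"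
    then show "s = t" using that by (cases a; cases b; cases c; cases d) (simp_all add: f_def)
  qed
  have place: "place k (s, x) = (f s * k + nat x mod k, nat x div k)" for s x
    by (cases s) (simp add: place_def f_def)
  have "inj_on (place k) (UNIV \<times> res (int (k * p)))"
  proof (rule inj_onI)
    fix a b assume ab: "a \<in> UNIV \<times> res (int (k * p))" "b \<in> UNIV \<times> res (int (k * p))" "place k a = place k b"
    obtain s x t y where eq: "a = (s, x)" "b = (t, y)" by (metis surj_pair)
    have e: "f s * k + nat x mod k = f t * k + nat y mod k" "nat x div k = nat y div k"
      using ab(3) unfolding eq place by simp_all
    have "(f s * k + nat x mod k) div k = f s" "(f t * k + nat y mod k) div k = f t"
      using assms by simp_all
    then have "f s = f t" using e(1) by metis
    moreover from this have "nat x mod k = nat y mod k" using e(1) by simp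
    then have "nat x = nat y" using e(2) by (metis mult_div_mod_eq)
    then have "x = y" using ab(1,2) by (simp add: eq res_def eq_nat_nat_iff)
    ultimately show "a = b" using f_inj by (simp add: eq)
  qed
  moreover have "place k ` (UNIV \<times> res (int (k * p))) = {0..<4 * k} \<times> {0..<p}"
  proof (intro equalityI subsetI)
    fix q assume "q \<in> place k ` (UNIV \<times> res (int (k * p)))"
    then obtain s x where x: "q = place k (s, x)" "x \<in> res (int (k * p))" by auto
    then have "nat x < k * p" by (simp add: res_def nat_less_iff)
    then have "nat x div k < p" by (simp add: less_mult_imp_div_less mult.commute)
    moreover have "f s * k + nat x mod k < 4 * k"
    proof -
      have "f s * k + nat x mod k < Suc (f s) * k" using assms by simp
      also have "\<dots> \<le> 4 * k" using f4[of s] by (intro mult_right_mono) simp_all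
      finally show ?thesis .
    qed
    ultimately show "q \<in> {0..<4 * k} \<times> {0..<p}" by (simp add: x place)
  next
    fix q assume "q \<in> {0..<4 * k} \<times> {0..<p}"
    then obtain j y where q: "q = (j, y)" "j < 4 * k" "y < p" by auto
    have "j div k < 4" using q(2) by (simp add: less_mult_imp_div_less)
    then have "j div k = 0 \<or> j div k = 1 \<or> j div k = 2 \<or> j div k = 3" by linarith
    then obtain s where s: "f s = j div k"
    proof (elim disjE)
      assume "j div k = 0" then show ?thesis using that[of "(L, L)"] by (simp add: f_def)
    next
      assume "j div k = 1" then show ?thesis using that[of "(L, R)"] by (simp add: f_def)
    next
      assume "j div k = 2" then show ?thesis using that[of "(R, L)"] by (simp add: f_def)
    next
      assume "j div k = 3" then show ?thesis using that[of "(R, R)"] by (simp add: f_def)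
    qed
    have "k * y + j mod k < k * p"
    proof -
      have "k * y + j mod k < k * Suc y" using assms by simp
      also have "\<dots> \<le> k * p" using q(3) by (intro mult_le_mono2) simp
      finally show ?thesis .
    qed
    then have "int (k * y + j mod k) \<in> res (int (k * p))" unfolding res_def by (metis atLeastLessThan_iff of_nat_0_le_iff of_nat_less_iff)
    moreover have "place k (s, int (k * y + j mod k)) = q"
    proof -
      have "(k * y + j mod k) mod k = j mod k" "(k * y + j mod k) div k = y" using assms by simp_all
      then show ?thesis unfolding place nat_int q(1) s by simp
    qed
    ultimately show "q \<in> place k ` (UNIV \<times> res (int (k * p)))" by (metis (no_types, lifting) SigmaI UNIV_I image_eqI)
  qed
  ultimately show ?thesis by (simp add: bij_betw_def)
qed

lemma place_translate:
  assumes "k > 0" "p > 0" "x \<in> res (int (k * p))"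
  shows "place k (s, (x + int k) mod int (k * p)) = rot p 1 (place k (s, x))"
proof -
  define X where "X = nat x"
  have x: "x = int X" using assms(3) by (simp add: X_def res_def)
  have "(x + int k) mod int (k * p) = int ((X + k) mod (k * p))" by (simp add: x zmod_int)
  moreover have "(X + k) mod (k * p) = k * ((X div k + 1) mod p) + X mod k"
    using assms(1) by (simp add: mod_mult2_eq)
  ultimately have e: "nat ((x + int k) mod int (k * p)) = k * ((X div k + 1) mod p) + X mod k"
    by (simp only: nat_int)
  have m: "(k * ((X div k + 1) mod p) + X mod k) mod k = X mod k"
    "(k * ((X div k + 1) mod p) + X mod k) div k = (X div k + 1) mod p" using assms(1) by simp_all
  obtain c i where "s = (c, i)" by (cases s)
  then show ?thesis
    by (simp only: place_def rot_def prod.case e m X_def[symmetric])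
qed

lemma cyclic_sqs_base:
  assumes "coprime (k * p) 6" "k * p > 0"
  shows "\<exists>\<B>. cyclic_sqs (4 * k) p \<B>"
proof -
  have kp: "k > 0" "p > 0" using assms(2) by simp_all
  interpret coprime_six "int (k * p)"
  proof
    show "int (k * p) > 0" using assms(2) by simp
    have "coprime (int (k * p)) (int 6)" using assms(1) by (simp only: coprime_int_iff)
    then show "coprime (int (k * p)) 6" by simp
  qed
  have "rot p 1 ` place k ` B \<in> (`) (place k) ` quad (int (k * p))" if B: "B \<in> quad (int (k * p))" for B
  proof -
    let ?t = "\<lambda>(f, x). (f, (x + int k) mod int (k * p))"
    have "rot p 1 (place k q) = place k (?t q)" if "q \<in> B" for q
    proof -
      have "q \<in> UNIV \<times> res (int (k * p))" using card_quad[OF B] that by blast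
      then show ?thesis using place_translate[OF kp, of "snd q" "fst q"] by (cases q) simp
    qed
    then have eq: "rot p 1 ` place k ` B = place k ` ?t ` B" by (simp add: image_image)
    show ?thesis unfolding eq by (rule imageI, rule quad_translate[OF B])
  qed
  then have "cyclic_sqs (4 * k) p ((`) (place k) ` quad (int (k * p)))"
    using sqs_image[OF sqs_quad bij_place[OF kp(1)]] by (auto simp: cyclic_sqs_def)
  then show ?thesis ..
qed

section \<open>Doubling\<close>

text \<open>A one-factorization of the complete graph on P, encoded as an edge colouring: the
  colours are the factors, and by the second clause each colour class is a perfect matching.\<close>

definition one_fact :: "'a set \<Rightarrow> 'c set \<Rightarrow> ('a \<Rightarrow> 'a \<Rightarrow> 'c) \<Rightarrow> bool" where
  "one_fact P K \<chi> \<longleftrightarrow>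
     (\<forall>a\<in>P. \<forall>b\<in>P. a \<noteq> b \<longrightarrow> \<chi> a b \<in> K \<and> \<chi> a b = \<chi> b a) \<and>
     (\<forall>a\<in>P. \<forall>\<kappa>\<in>K. \<exists>!b. b \<in> P \<and> b \<noteq> a \<and> \<chi> a b = \<kappa>)"

definition mixed :: "'a set \<Rightarrow> ('a \<Rightarrow> 'a \<Rightarrow> 'c) \<Rightarrow> ('c \<Rightarrow> 'c) \<Rightarrow> ('a \<times> bool) set set" where
  "mixed P \<chi> \<pi> = {{(a, False), (b, False), (c, True), (d, True)} | a b c d.
     {a, b, c, d} \<subseteq> P \<and> a \<noteq> b \<and> c \<noteq> d \<and> \<chi> a b = \<pi> (\<chi> c d)}"

definition double :: "'a set \<Rightarrow> 'a set set \<Rightarrow> ('a \<Rightarrow> 'a \<Rightarrow> 'c) \<Rightarrow> ('c \<Rightarrow> 'c) \<Rightarrow> ('a \<times> bool) set set" where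
  "double P \<B> \<chi> \<pi> = (\<lambda>(B, e). B \<times> {e}) ` (\<B> \<times> UNIV) \<union> mixed P \<chi> \<pi>"

text \<open>That \<open>\<pi>\<close> is an involution makes \<open>mixed\<close> symmetric in the
  two copies; \<open>mixedI\<close> and \<open>mixedE\<close> can therefore start from either value
  of e.\<close>

locale doubling =
  fixes P :: "'a set" and \<B> K and \<chi> :: "'a \<Rightarrow> 'a \<Rightarrow> 'c" and \<pi> :: "'c \<Rightarrow> 'c"
  assumes sqs: "sqs P \<B>" and fact: "one_fact P K \<chi>"
    and inv: "\<And>\<kappa>. \<kappa> \<in> K \<Longrightarrow> \<pi> \<kappa> \<in> K" "\<And>\<kappa>. \<kappa> \<in> K \<Longrightarrow> \<pi> (\<pi> \<kappa>) = \<kappa>"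
begin

lemma color: "a \<in> P \<Longrightarrow> b \<in> P \<Longrightarrow> a \<noteq> b \<Longrightarrow> \<chi> a b \<in> K \<and> \<chi> a b = \<chi> b a"
  using fact by (auto simp: one_fact_def)

lemma mate:
  assumes "a \<in> P" "\<kappa> \<in> K"
  obtains b where "b \<in> P" "b \<noteq> a" "\<chi> a b = \<kappa>" "\<And>b'. b' \<in> P \<Longrightarrow> b' \<noteq> a \<Longrightarrow> \<chi> a b' = \<kappa> \<Longrightarrow> b' = b"
  using fact assms unfolding one_fact_def by metis

lemma mixedI:
  "\<lbrakk>{a, b, c, d} \<subseteq> P; a \<noteq> b; c \<noteq> d; \<chi> a b = \<pi> (\<chi> c d)\<rbrakk>
    \<Longrightarrow> {(a, e), (b, e), (c, \<not> e), (d, \<not> e)} \<in> mixed P \<chi> \<pi>"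
proof (cases e)
  case True
  assume *: "{a, b, c, d} \<subseteq> P" "a \<noteq> b" "c \<noteq> d" "\<chi> a b = \<pi> (\<chi> c d)"
  then have "\<chi> c d = \<pi> (\<chi> a b)" using inv(2) color[of c d] by auto
  then have "{(c, False), (d, False), (a, True), (b, True)} \<in> mixed P \<chi> \<pi>"
    unfolding mixed_def using * by (intro CollectI exI[of _ c] exI[of _ d] exI[of _ a] exI[of _ b]) auto
  moreover have "{(a, e), (b, e), (c, \<not> e), (d, \<not> e)} = {(c, False), (d, False), (a, True), (b, True)}"
    using True by auto
  ultimately show ?thesis by simp
qed (auto simp: mixed_def)

lemma mixedE:
  assumes "B \<in> mixed P \<chi> \<pi>"
  obtains a b c d where "B = {(a, e), (b, e), (c, \<not> e), (d, \<not> e)}" "{a, b, c, d} \<subseteq> P"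
    "a \<noteq> b" "c \<noteq> d" "\<chi> a b = \<pi> (\<chi> c d)" "\<chi> c d = \<pi> (\<chi> a b)"
proof -
  obtain a b c d where *: "B = {(a, False), (b, False), (c, True), (d, True)}" "{a, b, c, d} \<subseteq> P"
    "a \<noteq> b" "c \<noteq> d" "\<chi> a b = \<pi> (\<chi> c d)" using assms by (auto simp: mixed_def)
  then have **: "\<chi> c d = \<pi> (\<chi> a b)" using inv(2) color[of c d] by auto
  show ?thesis
  proof (cases e)
    case True
    have "B = {(c, True), (d, True), (a, False), (b, False)}" using * by auto
    then show ?thesis by (intro that[of c d a b]) (use * ** True in auto)
  next
    case False
    then show ?thesis by (intro that[of a b c d]) (use * ** in auto)
  qed
qed

text \<open>The colour of the edge ab prescribes the factor to use in the other copy, and in that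
  factor c has exactly one mate.\<close>

lemma double_two:
  assumes "{a, b, c} \<subseteq> P" "a \<noteq> b"
  shows "\<exists>!B. B \<in> double P \<B> \<chi> \<pi> \<and> {(a, e), (b, e), (c, \<not> e)} \<subseteq> B"
proof -
  have "\<pi> (\<chi> a b) \<in> K" using assms color[of a b] inv by auto
  then obtain d where d: "d \<in> P" "d \<noteq> c" "\<chi> c d = \<pi> (\<chi> a b)"
    "\<And>d'. d' \<in> P \<Longrightarrow> d' \<noteq> c \<Longrightarrow> \<chi> c d' = \<pi> (\<chi> a b) \<Longrightarrow> d' = d"
    using mate assms(1) by (metis insert_subset)
  show ?thesis
  proof (rule ex1I[of _ "{(a, e), (b, e), (c, \<not> e), (d, \<not> e)}"])
    have "\<chi> a b = \<pi> (\<chi> c d)" using d(3) inv(2) assms color[of a b] by auto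
    then have "{(a, e), (b, e), (c, \<not> e), (d, \<not> e)} \<in> mixed P \<chi> \<pi>"
      using assms d(1,2) by (intro mixedI) auto
    then show "{(a, e), (b, e), (c, \<not> e), (d, \<not> e)} \<in> double P \<B> \<chi> \<pi> \<and>
        {(a, e), (b, e), (c, \<not> e)} \<subseteq> {(a, e), (b, e), (c, \<not> e), (d, \<not> e)}"
      by (simp add: double_def)
    fix B assume B: "B \<in> double P \<B> \<chi> \<pi> \<and> {(a, e), (b, e), (c, \<not> e)} \<subseteq> B"
    then have "B \<in> mixed P \<chi> \<pi>" by (auto simp: double_def)
    then obtain a' b' c' d' where *: "B = {(a', e), (b', e), (c', \<not> e), (d', \<not> e)}"
      "{a', b', c', d'} \<subseteq> P" "a' \<noteq> b'" "c' \<noteq> d'" "\<chi> a' b' = \<pi> (\<chi> c' d')" "\<chi> c' d' = \<pi> (\<chi> a' b')"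
      by (rule mixedE[of B e])
    have ab: "a = a' \<and> b = b' \<or> a = b' \<and> b = a'" using B assms(2) unfolding *(1) by auto
    then have "\<chi> a b = \<chi> a' b'" using color[of a' b'] *(2,3) by auto
    then have cd: "\<chi> c' d' = \<pi> (\<chi> a b)" "\<chi> d' c' = \<pi> (\<chi> a b)" using *(2,4,6) color[of c' d'] by auto
    have "c = c' \<or> c = d'" using B unfolding *(1) by auto
    then have "c = c' \<and> d = d' \<or> c = d' \<and> d = c'" using d(4)[of d'] d(4)[of c'] cd *(2,4) by auto
    then show "B = {(a, e), (b, e), (c, \<not> e), (d, \<not> e)}" using ab unfolding *(1) by auto
  qed
qed

lemma double_three:
  assumes "{a, b, c} \<subseteq> P" "distinct [a, b, c]"
  shows "\<exists>!B. B \<in> double P \<B> \<chi> \<pi> \<and> {(a, e), (b, e), (c, e)} \<subseteq> B"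
proof -
  have "a \<in> P" "b \<in> P" "c \<in> P" using assms(1) by auto
  then obtain B where B: "B \<in> \<B>" "{a, b, c} \<subseteq> B" "\<And>B'. B' \<in> \<B> \<Longrightarrow> {a, b, c} \<subseteq> B' \<Longrightarrow> B' = B"
    using sqs_triple[OF sqs _ _ _ assms(2)] by blast
  show ?thesis
  proof (rule ex1I[of _ "B \<times> {e}"])
    show "B \<times> {e} \<in> double P \<B> \<chi> \<pi> \<and> {(a, e), (b, e), (c, e)} \<subseteq> B \<times> {e}"
      using B(1,2) by (auto simp: double_def)
    fix B' assume B': "B' \<in> double P \<B> \<chi> \<pi> \<and> {(a, e), (b, e), (c, e)} \<subseteq> B'"
    have "B' \<notin> mixed P \<chi> \<pi>"
    proof
      assume "B' \<in> mixed P \<chi> \<pi>"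
      then obtain a' b' c' d' where "B' = {(a', e), (b', e), (c', \<not> e), (d', \<not> e)}"
        by (rule mixedE[of B' e])
      then show False using B' assms(2) by auto
    qed
    then show "B' = B \<times> {e}" using B' B(3) by (auto simp: double_def)
  qed
qed

lemma sqs_double: "sqs (P \<times> UNIV) (double P \<B> \<chi> \<pi>)"
  unfolding sqs_def
proof (intro conjI ballI impI)
  show "finite (P \<times> (UNIV :: bool set))" using sqs by (simp add: sqs_def)
next
  fix B assume "B \<in> double P \<B> \<chi> \<pi>"
  then consider B' e where "B' \<in> \<B>" "B = B' \<times> {e}" | "B \<in> mixed P \<chi> \<pi>" by (auto simp: double_def)
  then have "B \<subseteq> P \<times> UNIV \<and> card B = 4"
  proof cases
    case 1
    then show ?thesis using sqs_block[OF sqs 1(1)] by (auto simp: card_cartesian_product)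
  next
    case 2
    then obtain a b c d where "B = {(a, False), (b, False), (c, \<not> False), (d, \<not> False)}" "{a, b, c, d} \<subseteq> P"
      "a \<noteq> b" "c \<noteq> d" by (rule mixedE[of B False])
    then show ?thesis by auto
  qed
  then show "B \<subseteq> P \<times> UNIV" "card B = 4" by auto
next
  fix x y z assume *: "x \<in> P \<times> (UNIV :: bool set)" "y \<in> P \<times> (UNIV :: bool set)" "z \<in> P \<times> (UNIV :: bool set)" "distinct [x, y, z]"
  obtain a e b f c g where eq: "x = (a, e)" "y = (b, f)" "z = (c, g)" by (metis surj_pair)
  consider "f = e" "g = e" | "f = e" "g = (\<not> e)" | "f = (\<not> e)" "g = e" | "f = (\<not> e)" "g = (\<not> e)" by blast
  then show "\<exists>!B. B \<in> double P \<B> \<chi> \<pi> \<and> {x, y, z} \<subseteq> B"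
  proof cases
    case 1
    then show ?thesis using double_three[of a b c e] * by (auto simp: eq)
  next
    case 2
    then show ?thesis using double_two[of a b c e] * by (auto simp: eq)
  next
    case 3
    then show ?thesis using double_two[of a c b e] * by (auto simp: eq insert_commute)
  next
    case 4
    then show ?thesis using double_two[of b c a "\<not> e"] * by (auto simp: eq insert_commute)
  qed
qed

text \<open>A map of P that permutes the colours by \<open>\<tau>\<close> respects the gluing as
  soon as \<open>\<tau>\<close> commutes with \<open>\<pi>\<close>. Exchanging the copies by
  \<open>Not\<close> comes for free from the symmetry of \<open>mixed\<close>.\<close>

lemma double_map:
  assumes s: "\<And>B. B \<in> \<B> \<Longrightarrow> s ` B \<in> \<B>" "\<And>a. a \<in> P \<Longrightarrow> s a \<in> P" "inj_on s P"
    and \<tau>: "\<And>a b. a \<in> P \<Longrightarrow> b \<in> P \<Longrightarrow> a \<noteq> b \<Longrightarrow> \<chi> (s a) (s b) = \<tau> (\<chi> a b)"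
      "\<And>\<kappa>. \<kappa> \<in> K \<Longrightarrow> \<pi> (\<tau> \<kappa>) = \<tau> (\<pi> \<kappa>)"
    and f: "f = id \<or> f = Not"
    and B: "B \<in> double P \<B> \<chi> \<pi>"
  shows "map_prod s f ` B \<in> double P \<B> \<chi> \<pi>"
proof -
  consider B' e where "B' \<in> \<B>" "B = B' \<times> {e}" | "B \<in> mixed P \<chi> \<pi>" using B by (auto simp: double_def)
  then show ?thesis
  proof cases
    case 1
    then have "map_prod s f ` B = (s ` B') \<times> {f e}" by auto
    then show ?thesis using s(1)[OF 1(1)] by (auto simp: double_def)
  next
    case 2
    then obtain a b c d where *: "B = {(a, False), (b, False), (c, \<not> False), (d, \<not> False)}" "{a, b, c, d} \<subseteq> P"
      "a \<noteq> b" "c \<noteq> d" "\<chi> a b = \<pi> (\<chi> c d)" by (rule mixedE[of B False])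
    have "\<chi> (s a) (s b) = \<pi> (\<chi> (s c) (s d))" using * \<tau> color[of c d] by auto
    moreover have "s a \<noteq> s b" "s c \<noteq> s d" "{s a, s b, s c, s d} \<subseteq> P"
      using * s(2,3) by (auto simp: inj_on_def)
    ultimately have "{(s a, f False), (s b, f False), (s c, \<not> f False), (s d, \<not> f False)} \<in> mixed P \<chi> \<pi>"
      by (intro mixedI)
    moreover have "map_prod s f ` B = {(s a, f False), (s b, f False), (s c, \<not> f False), (s d, \<not> f False)}"
      using f unfolding *(1) by auto
    ultimately show ?thesis by (simp add: double_def)
  qed
qed

text \<open>A block fixed by the exchange repeats one edge in both copies, so the colour of this
  edge is fixed by \<open>\<pi>\<close>. The edges of the factor \<open>\<kappa>\<^sub>0\<close>
  cover P without overlap; taken in both copies they partition all points into sets of size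
  4.\<close>

lemma card_flip_fixed:
  assumes "\<kappa>\<^sub>0 \<in> K" "\<And>\<kappa>. \<kappa> \<in> K \<Longrightarrow> \<pi> \<kappa> = \<kappa> \<longleftrightarrow> \<kappa> = \<kappa>\<^sub>0"
  shows "4 * card {B \<in> double P \<B> \<chi> \<pi>. map_prod id Not ` B = B} = card (P \<times> (UNIV :: bool set))"
proof -
  have fix_iff: "B \<in> double P \<B> \<chi> \<pi> \<and> map_prod id Not ` B = B \<longleftrightarrow>
      (\<exists>a b. B = {a, b} \<times> UNIV \<and> a \<in> P \<and> b \<in> P \<and> a \<noteq> b \<and> \<chi> a b = \<kappa>\<^sub>0)" (is "?l \<longleftrightarrow> ?r") for B
  proof
    assume B: ?l
    have "B \<in> mixed P \<chi> \<pi>"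
    proof (rule ccontr)
      assume "B \<notin> mixed P \<chi> \<pi>"
      then obtain B' e where *: "B' \<in> \<B>" "B = B' \<times> {e}" using B by (auto simp: double_def)
      moreover have "B' \<noteq> {}" using sqs_block(2)[OF sqs *(1)] by auto
      ultimately obtain x where "(x, e) \<in> B" by auto
      then have "map_prod id Not (x, e) \<in> B" using B by blast
      then show False using *(2) by simp
    qed
    then obtain a b c d where *: "B = {(a, False), (b, False), (c, \<not> False), (d, \<not> False)}" "{a, b, c, d} \<subseteq> P"
      "a \<noteq> b" "c \<noteq> d" "\<chi> a b = \<pi> (\<chi> c d)" by (rule mixedE[of B False])
    have "map_prod id Not (a, False) \<in> B" "map_prod id Not (b, False) \<in> B"
      using B *(1) by blast+
    then have "a = c \<or> a = d" "b = c \<or> b = d" unfolding *(1) by simp_all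
    then have cd: "c = a \<and> d = b \<or> c = b \<and> d = a" using *(3) by blast
    have ab: "\<chi> a b \<in> K" "\<chi> a b = \<chi> b a" using color[of a b] *(2,3) by blast+
    have "\<chi> c d = \<chi> a b" using cd ab(2) by metis
    then have "\<chi> a b = \<kappa>\<^sub>0" using *(5) assms(2)[OF ab(1)] by metis
    moreover have "B = {a, b} \<times> UNIV" using cd unfolding *(1) by (auto simp: UNIV_bool)
    ultimately show ?r using * by blast
  next
    assume ?r
    then obtain a b where *: "B = {a, b} \<times> UNIV" "a \<in> P" "b \<in> P" "a \<noteq> b" "\<chi> a b = \<kappa>\<^sub>0" by blast
    have "{(a, False), (b, False), (a, \<not> False), (b, \<not> False)} \<in> mixed P \<chi> \<pi>"
      by (rule mixedI) (use * assms(2)[OF assms(1)] in auto)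
    moreover have "{(a, False), (b, False), (a, \<not> False), (b, \<not> False)} = B"
      unfolding *(1) by (auto simp: UNIV_bool)
    moreover have "map_prod id Not ` B = B"
      unfolding *(1) by (auto simp: image_iff)
    ultimately show ?l by (simp add: double_def)
  qed
  let ?S = "{B \<in> double P \<B> \<chi> \<pi>. map_prod id Not ` B = B}"
  have "4 * card ?S = card (\<Union>?S)"
  proof (rule card_partition)
    show "finite ?S" using sqs_finite[OF sqs_double] by simp
    show "finite (\<Union>?S)"
    proof (rule finite_subset)
      show "\<Union>?S \<subseteq> P \<times> UNIV" using sqs_block(1)[OF sqs_double] by blast
    qed (use sqs in \<open>simp add: sqs_def\<close>)
    show "card B = 4" if "B \<in> ?S" for B using that sqs_block(2)[OF sqs_double] by blast
    show "B \<inter> C = {}" if BC: "B \<in> ?S" "C \<in> ?S" "B \<noteq> C" for B C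
    proof (rule ccontr)
      assume "B \<inter> C \<noteq> {}"
      then obtain x e where x: "(x, e) \<in> B" "(x, e) \<in> C" by auto
      obtain a b where B: "B = {a, b} \<times> UNIV" "a \<in> P" "b \<in> P" "a \<noteq> b" "\<chi> a b = \<kappa>\<^sub>0" using BC(1) fix_iff[of B] by blast
      obtain c d where C: "C = {c, d} \<times> UNIV" "c \<in> P" "d \<in> P" "c \<noteq> d" "\<chi> c d = \<kappa>\<^sub>0" using BC(2) fix_iff[of C] by blast
      have "x \<in> P" using x B by auto
      then obtain y where y: "\<And>b'. b' \<in> P \<Longrightarrow> b' \<noteq> x \<Longrightarrow> \<chi> x b' = \<kappa>\<^sub>0 \<Longrightarrow> b' = y" using mate[OF _ assms(1)] by metis
      have "\<chi> b a = \<kappa>\<^sub>0" "\<chi> d c = \<kappa>\<^sub>0" using B C color[of a b] color[of c d] by metis+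
      then have "x = a \<and> b = y \<or> x = b \<and> a = y" "x = c \<and> d = y \<or> x = d \<and> c = y"
        using x B C y by (metis SigmaD1 insertE singletonD)+
      then have "{a, b} = {x, y}" "{c, d} = {x, y}" by blast+
      then show False using BC(3) B(1) C(1) by simp
    qed
  qed
  also have "\<Union>?S = P \<times> UNIV"
  proof (intro equalityI subsetI)
    fix q assume "q \<in> P \<times> (UNIV :: bool set)"
    then obtain a e where q: "q = (a, e)" "a \<in> P" by auto
    obtain b where "b \<in> P" "b \<noteq> a" "\<chi> a b = \<kappa>\<^sub>0" using mate[OF q(2) assms(1)] by metis
    then have "{a, b} \<times> UNIV \<in> ?S" using fix_iff[of "{a, b} \<times> UNIV"] q by blast
    then show "q \<in> \<Union>?S" using q by blast
  qed (use sqs_block(1)[OF sqs_double] in blast)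
  finally show ?thesis .
qed

end

section \<open>One-factorizations compatible with the shift\<close>

definition clique_color :: "nat \<Rightarrow> nat \<Rightarrow> nat \<Rightarrow> nat" where
  "clique_color m i j = (if i = m - 1 then 2 * j else if j = m - 1 then 2 * i else i + j) mod (m - 1)"

text \<open>The round-robin schedule: vertices of Z/(m-1) are coloured by their sum, and
  \<open>m - 1\<close> serves as a point at infinity, the mate of i in the factor 2i, where i would
  otherwise be paired with itself. Since m - 1 is odd, 2 is invertible.\<close>

lemma one_fact_clique:
  assumes "even m" "m \<ge> 2"
  shows "one_fact {0..<m} {0..<m - 1} (clique_color m)"
  unfolding one_fact_def
proof (intro conjI ballI impI)
  define M where "M = m - 1"
  have M: "odd M" "M > 0" "m = Suc M" using assms by (auto simp: M_def)
  show "clique_color m i j \<in> {0..<m - 1}" for i j using M by (simp add: clique_color_def)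
  show "clique_color m i j = clique_color m j i" for i j by (simp add: clique_color_def add.commute)
  fix i c assume i: "i \<in> {0..<m}" and c: "c \<in> {0..<m - 1}"
  have half: "j = j'" if "j < M" "j' < M" "(2 * j) mod M = (2 * j') mod M" for j j'
  proof -
    have "[2 * j = 2 * j'] (mod M)" using that(3) by (simp add: cong_def)
    then have "[j = j'] (mod M)" using M(1) by (simp add: cong_mult_lcancel_nat)
    then show ?thesis using that by (simp add: cong_def)
  qed
  have sum: "j = j'" if "j < M" "j' < M" "(i + j) mod M = (i + j') mod M" for j j'
  proof -
    have "[i + j = i + j'] (mod M)" using that(3) by (simp add: cong_def)
    then have "[j = j'] (mod M)" by (simp only: cong_add_lcancel_nat)
    then show ?thesis using that by (simp add: cong_def)
  qed
  have c': "c < M" using c M by simp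
  show "\<exists>!j. j \<in> {0..<m} \<and> j \<noteq> i \<and> clique_color m i j = c"
  proof (cases "i = M")
    case True
    have "inj_on (\<lambda>j. (2 * j) mod M) {0..<M}" by (rule inj_onI, rule half) auto
    then have "(\<lambda>j. (2 * j) mod M) ` {0..<M} = {0..<M}"
      by (intro endo_inj_surj) (use M(2) in auto)
    then have "c \<in> (\<lambda>j. (2 * j) mod M) ` {0..<M}" using c' by simp
    then obtain j where j: "j < M" "(2 * j) mod M = c" by auto
    show ?thesis
    proof (rule ex1I[of _ j])
      show "j \<in> {0..<m} \<and> j \<noteq> i \<and> clique_color m i j = c"
        using j True M(3) by (simp add: clique_color_def)
      fix j' assume "j' \<in> {0..<m} \<and> j' \<noteq> i \<and> clique_color m i j' = c"
      then have "j' < M" "(2 * j') mod M = c" using True M(3) by (auto simp: clique_color_def)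
      then show "j' = j" using half[of j' j] j by metis
    qed
  next
    case False
    then have iM: "i < M" using i M(3) by simp
    show ?thesis
    proof (cases "(2 * i) mod M = c")
      case True
      show ?thesis
      proof (rule ex1I[of _ M])
        show "M \<in> {0..<m} \<and> M \<noteq> i \<and> clique_color m i M = c"
          using True iM M(3) by (simp add: clique_color_def)
        fix j assume j: "j \<in> {0..<m} \<and> j \<noteq> i \<and> clique_color m i j = c"
        show "j = M"
        proof (rule ccontr)
          assume "j \<noteq> M"
          then have "j < M" "(i + j) mod M = c" using j iM M(3) by (simp_all add: clique_color_def)
          moreover have "(i + i) mod M = c" using True by (simp only: mult_2)
          ultimately have "j = i" using sum[of j i] iM by metis
          then show False using j by simp
        qed
      qed
    next
      case nc: False
      have "inj_on (\<lambda>j. (i + j) mod M) {0..<M}" by (rule inj_onI, rule sum) auto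
      then have "(\<lambda>j. (i + j) mod M) ` {0..<M} = {0..<M}"
        by (intro endo_inj_surj) (use M(2) in auto)
      then have "c \<in> (\<lambda>j. (i + j) mod M) ` {0..<M}" using c' by simp
    then obtain j where j: "j < M" "(i + j) mod M = c" by auto
      show ?thesis
      proof (rule ex1I[of _ j])
        have "j \<noteq> i"
        proof
          assume "j = i"
          then have "(2 * i) mod M = c" using j(2) by (simp only: mult_2)
          with nc show False ..
        qed
        then show "j \<in> {0..<m} \<and> j \<noteq> i \<and> clique_color m i j = c"
          using j iM M(3) by (simp add: clique_color_def)
        fix j' assume j': "j' \<in> {0..<m} \<and> j' \<noteq> i \<and> clique_color m i j' = c"
        have "j' \<noteq> M"
        proof
          assume "j' = M"
          then have "(2 * i) mod M = c" using j' iM M(3) by (simp add: clique_color_def)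
          with nc show False ..
        qed
        then have "j' < M" "(i + j') mod M = c" using j' iM M(3) by (simp_all add: clique_color_def)
        then show "j' = j" using sum[of j' j] j by metis
      qed
    qed
  qed
qed

text \<open>The difference is oriented from the lower fibre to the higher one, so that between
  distinct fibres it does not depend on the order of the two points.\<close>

definition diff_mod :: "nat \<Rightarrow> nat \<Rightarrow> nat \<Rightarrow> nat \<Rightarrow> nat \<Rightarrow> int" where
  "diff_mod p i j x y = (if i < j then int y - int x else int x - int y) mod int p"

definition sum_mod :: "nat \<Rightarrow> nat \<Rightarrow> nat \<Rightarrow> int" where
  "sum_mod p x y = (int x + int y) mod int p"

lemma int_mod_unique: "x < p \<Longrightarrow> y < p \<Longrightarrow> int p dvd int x - int y \<Longrightarrow> x = y"
  by (metis mod_eq_dvd_iff mod_less of_nat_eq_iff zmod_int)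

lemma sum_mod_unique:
  assumes "p > 0" "d \<in> {0..<int p}"
  obtains y where "y < p" "\<And>y'. y' < p \<Longrightarrow> sum_mod p x y' = d \<longleftrightarrow> y' = y"
proof
  let ?y = "nat ((d - int x) mod int p)"
  show y: "?y < p" using assms(1) by (simp add: nat_less_iff)
  have eq: "sum_mod p x ?y = d" using assms by (simp add: sum_mod_def mod_simps)
  show "sum_mod p x y' = d \<longleftrightarrow> y' = ?y" if "y' < p" for y'
  proof
    assume "sum_mod p x y' = d"
    then have "int p dvd (int x + int y') - (int x + int ?y)"
      using eq unfolding sum_mod_def by (metis mod_eq_dvd_iff)
    then show "y' = ?y" using that y by (intro int_mod_unique[of _ p]) simp_all
  qed (use eq in simp)
qed

lemma diff_mod_unique:
  assumes "p > 0" "d \<in> {0..<int p}"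
  obtains y where "y < p" "\<And>y'. y' < p \<Longrightarrow> diff_mod p i j x y' = d \<longleftrightarrow> y' = y"
proof
  define y where "y = nat ((if i < j then d + int x else int x - d) mod int p)"
  show y: "y < p" using assms(1) by (simp add: y_def nat_less_iff)
  have eq: "diff_mod p i j x y = d" using assms by (simp add: diff_mod_def y_def mod_simps)
  show "diff_mod p i j x y' = d \<longleftrightarrow> y' = y" if "y' < p" for y'
  proof
    assume "diff_mod p i j x y' = d"
    then have "int p dvd (if i < j then int y' - int x else int x - int y') - (if i < j then int y - int x else int x - int y)"
      using eq unfolding diff_mod_def by (metis mod_eq_dvd_iff)
    then have "int p dvd int y' - int y"
      by (cases "i < j") (simp_all add: dvd_diff_commute)
    then show "y' = y" using that y by (intro int_mod_unique[of _ p])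
  qed (use eq in simp)
qed

text \<open>
  Pairs inside a fibre cannot lie in a shift invariant factor, since \<^term>\<open>p\<close> is odd.  They
  lie in the factors \<open>(0, s)\<close>, which the shift permutes in one cycle of length \<^term>\<open>p\<close>.
  Colouring the pairs with \<open>g i j = 1\<close> by sums rather than differences yields a second such
  cycle \<open>(1, s)\<close>, so that the involution \<open>swap_color\<close> below can exchange the two; a single odd
  cycle has no shift equivariant involution but the identity.
\<close>

type_synonym color = "nat \<times> int"

definition point_color :: "nat \<Rightarrow> (nat \<Rightarrow> nat \<Rightarrow> nat) \<Rightarrow> nat \<times> nat \<Rightarrow> nat \<times> nat \<Rightarrow> color" where
  "point_color p g = (\<lambda>(i, x) (j, y).
     if i = j \<or> g i j = 0 \<and> x = y then (0, sum_mod p x y)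
     else if g i j = 0 then (2, diff_mod p i j x y)
     else if g i j = 1 then (1, sum_mod p x y)
     else (Suc (g i j), diff_mod p i j x y))"

text \<open>In the factor (0, s) a column x with 2x = s has no partner inside its own fibre. It
  borrows the cell of the same column in the fibre joined to it by the g-colour 0, which uses up the
  difference 0 of class 2. This leaves mp - 1 colours, as a one-factorization on mp points
  requires.\<close>

definition colors :: "nat \<Rightarrow> nat \<Rightarrow> color set" where
  "colors m p = {(c, d). c < m \<and> d \<in> {0..<int p} \<and> (c = 2 \<longrightarrow> d \<noteq> 0)}"

lemma sum_mod_range: "p > 0 \<Longrightarrow> sum_mod p x y \<in> {0..<int p}"
  by (simp add: sum_mod_def)

lemma diff_mod_range: "p > 0 \<Longrightarrow> diff_mod p i j x y \<in> {0..<int p}"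
  by (simp add: diff_mod_def)

lemma diff_mod_0: "x < p \<Longrightarrow> y < p \<Longrightarrow> diff_mod p i j x y = 0 \<longleftrightarrow> x = y"
proof
  assume xy: "x < p" "y < p" "diff_mod p i j x y = 0"
  then have "int p dvd (if i < j then int y - int x else int x - int y)"
    unfolding diff_mod_def by (simp add: dvd_eq_mod_eq_0)
  then have "int p dvd int x - int y" by (cases "i < j") (simp_all add: dvd_diff_commute)
  then show "x = y" using xy(1,2) by (intro int_mod_unique[of x p y])
qed (simp add: diff_mod_def)

text \<open>A colour determines the fibre of the partner through g, and then its column, because sum
  and difference are bijective in the second column.\<close>

lemma one_fact_point_color:
  assumes g: "one_fact {0..<m} {0..<m - 1} g" and m: "m \<ge> 4" and p: "p > 0"
  shows "one_fact ({0..<m} \<times> {0..<p}) (colors m p) (point_color p g)"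
proof -
  have gm: "g i j < m - 1" "g j i = g i j" if "i < m" "j < m" "i \<noteq> j" for i j
    using g[unfolded one_fact_def, THEN conjunct1, rule_format, of i j] that by simp_all
  have mate: "\<exists>j. j < m \<and> j \<noteq> i \<and> g i j = c \<and> (\<forall>j'. j' < m \<longrightarrow> j' \<noteq> i \<longrightarrow> g i j' = c \<longrightarrow> j' = j)"
    if ic: "i < m" "c < m - 1" for i c
  proof -
    have "\<exists>!j. j \<in> {0..<m} \<and> j \<noteq> i \<and> g i j = c"
      using g[unfolded one_fact_def, THEN conjunct2, rule_format, of i c] ic by simp
    then show ?thesis by (elim ex1E) (metis atLeastLessThan_iff zero_le)
  qed
  have closed: "point_color p g (i, x) (j, y) \<in> colors m p \<and> point_color p g (i, x) (j, y) = point_color p g (j, y) (i, x)"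
    if ij: "i < m" "x < p" "j < m" "y < p" "(i, x) \<noteq> (j, y)" for i x j y
  proof
    show "point_color p g (i, x) (j, y) \<in> colors m p"
    proof (cases "i = j")
      case True
      then show ?thesis using m p sum_mod_range[OF p] by (simp add: point_color_def colors_def)
    next
      case False
      then have "g i j < m - 1" using gm(1) ij by blast
      then have "Suc (g i j) < m" by simp
      then show ?thesis using m p False ij sum_mod_range[OF p] diff_mod_range[OF p] diff_mod_0[of x p y i j]
        by (simp add: point_color_def colors_def)
    qed
    have sm: "sum_mod p y x = sum_mod p x y" by (simp add: sum_mod_def add.commute)
    show "point_color p g (i, x) (j, y) = point_color p g (j, y) (i, x)"
    proof (cases "i = j")
      case True
      then show ?thesis using sm by (simp add: point_color_def)
    next
      case False
      have "diff_mod p j i y x = diff_mod p i j x y" using False by (auto simp: diff_mod_def)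
      moreover have "g j i = g i j" using gm(2) ij False by blast
      ultimately show ?thesis using sm False not_sym[OF False]
        by (cases "x = y") (simp_all add: point_color_def)
    qed
  qed
  have unique: "\<exists>!b. b \<in> {0..<m} \<times> {0..<p} \<and> b \<noteq> (i, x) \<and> point_color p g (i, x) b = (c, d)"
    if ic: "i < m" "x < p" "(c, d) \<in> colors m p" for i x c d
  proof -
    have d: "d \<in> {0..<int p}" "c < m" using ic(3) by (auto simp: colors_def)
    have *: "\<exists>!b. b \<in> {0..<m} \<times> {0..<p} \<and> b \<noteq> (i, x) \<and> point_color p g (i, x) b = (c, d)"
      if b: "j < m" "y < p" "(j, y) \<noteq> (i, x)" "point_color p g (i, x) (j, y) = (c, d)"
        "\<And>j' y'. j' < m \<Longrightarrow> y' < p \<Longrightarrow> (j', y') \<noteq> (i, x) \<Longrightarrow> point_color p g (i, x) (j', y') = (c, d) \<Longrightarrow> j' = j \<and> y' = y"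
      for j y
    proof (rule ex1I[of _ "(j, y)"])
      show "(j, y) \<in> {0..<m} \<times> {0..<p} \<and> (j, y) \<noteq> (i, x) \<and> point_color p g (i, x) (j, y) = (c, d)"
        using b(1-4) by simp
      fix q assume q: "q \<in> {0..<m} \<times> {0..<p} \<and> q \<noteq> (i, x) \<and> point_color p g (i, x) q = (c, d)"
      obtain j' y' where "q = (j', y')" by (cases q)
      then show "q = (j, y)" using b(5)[of j' y'] q by simp
    qed
    obtain ys where ys: "ys < p" "\<And>y'. y' < p \<Longrightarrow> sum_mod p x y' = d \<longleftrightarrow> y' = ys"
      using sum_mod_unique[OF p d(1)] by blast
    consider "c = 0" | "c = 1" | "c = 2" | "c \<ge> 3" by linarith
    then show ?thesis
    proof cases
      case 1
      have "0 < m - 1" using ic(1) m by simp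
      from mate[OF ic(1) this] obtain j where j: "j < m" "j \<noteq> i" "g i j = 0" "\<forall>j'. j' < m \<longrightarrow> j' \<noteq> i \<longrightarrow> g i j' = 0 \<longrightarrow> j' = j"
        by blast
      \<comment> \<open>\<open>ys = x\<close> is the column that the sum would pair with itself; it
        goes to the fibre j.\<close>
      show ?thesis
      proof (cases "ys = x")
        case True
        show ?thesis
        proof (rule *[of j x])
          show "point_color p g (i, x) (j, x) = (c, d)" using 1 j(2,3) ys ic True by (simp add: point_color_def)
          fix j' y' assume h: "j' < m" "y' < p" "(j', y') \<noteq> (i, x)" "point_color p g (i, x) (j', y') = (c, d)"
          from h(4) 1 have "i = j' \<or> g i j' = 0 \<and> x = y'" "sum_mod p x y' = d"
            by (auto simp: point_color_def split: if_splits)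
          then show "j' = j \<and> y' = x" using h ys(2)[of y'] True j(4) by auto
        qed (use j(1,2) ic in simp_all)
      next
        case False
        show ?thesis
        proof (rule *[of i ys])
          show "point_color p g (i, x) (i, ys) = (c, d)" using 1 ys(2)[OF ys(1)] by (simp add: point_color_def)
          fix j' y' assume h: "j' < m" "y' < p" "(j', y') \<noteq> (i, x)" "point_color p g (i, x) (j', y') = (c, d)"
          from h(4) 1 have "i = j' \<or> g i j' = 0 \<and> x = y'" "sum_mod p x y' = d"
            by (auto simp: point_color_def split: if_splits)
          then show "j' = i \<and> y' = ys" using h ys(2)[of y'] False by auto
        qed (use ys(1) ic False in simp_all)
      qed
    next
      case 2
      have "1 < m - 1" using ic(1) m by simp
      from mate[OF ic(1) this] obtain j where j: "j < m" "j \<noteq> i" "g i j = 1" "\<forall>j'. j' < m \<longrightarrow> j' \<noteq> i \<longrightarrow> g i j' = 1 \<longrightarrow> j' = j"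
        by blast
      show ?thesis
      proof (rule *[of j ys])
        show "point_color p g (i, x) (j, ys) = (c, d)" using 2 j(2,3) ys(2)[OF ys(1)] by (simp add: point_color_def)
        fix j' y' assume h: "j' < m" "y' < p" "(j', y') \<noteq> (i, x)" "point_color p g (i, x) (j', y') = (c, d)"
        from h(4) 2 have "i \<noteq> j'" "g i j' = 1" "sum_mod p x y' = d"
          by (auto simp: point_color_def split: if_splits)
        then show "j' = j \<and> y' = ys" using h(1,2) ys(2)[of y'] j(4) by metis
      qed (use j(1,2) ys(1) in simp_all)
    next
      case 3
      have d0: "d \<noteq> 0" using ic(3) 3 by (simp add: colors_def)
      have "0 < m - 1" using ic(1) m by simp
      from mate[OF ic(1) this] obtain j where j: "j < m" "j \<noteq> i" "g i j = 0" "\<forall>j'. j' < m \<longrightarrow> j' \<noteq> i \<longrightarrow> g i j' = 0 \<longrightarrow> j' = j"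
        by blast
      obtain yd where yd: "yd < p" "\<And>y'. y' < p \<Longrightarrow> diff_mod p i j x y' = d \<longleftrightarrow> y' = yd"
        using diff_mod_unique[OF p d(1)] by blast
      have "yd \<noteq> x" using yd(2)[of yd] yd(1) diff_mod_0[of x p yd i j] ic(2) d0 by metis
      show ?thesis
      proof (rule *[of j yd])
        show "point_color p g (i, x) (j, yd) = (c, d)" using 3 j(2,3) yd(2)[OF yd(1)] \<open>yd \<noteq> x\<close> by (simp add: point_color_def)
        fix j' y' assume h: "j' < m" "y' < p" "(j', y') \<noteq> (i, x)" "point_color p g (i, x) (j', y') = (c, d)"
        from h(4) 3 have "i \<noteq> j'" "g i j' = 0" "diff_mod p i j' x y' = d"
          by (auto simp: point_color_def split: if_splits)
        then show "j' = j \<and> y' = yd" using h(1,2) yd(2)[of y'] j(4) by metis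
      qed (use j(1,2) yd(1) in simp_all)
    next
      case 4
      have "c - 1 < m - 1" using ic(1) m d(2) 4 by simp
      from mate[OF ic(1) this] obtain j where j: "j < m" "j \<noteq> i" "g i j = c - 1" "\<forall>j'. j' < m \<longrightarrow> j' \<noteq> i \<longrightarrow> g i j' = c - 1 \<longrightarrow> j' = j"
        by blast
      obtain yd where yd: "yd < p" "\<And>y'. y' < p \<Longrightarrow> diff_mod p i j x y' = d \<longleftrightarrow> y' = yd"
        using diff_mod_unique[OF p d(1)] by blast
      show ?thesis
      proof (rule *[of j yd])
        show "point_color p g (i, x) (j, yd) = (c, d)" using 4 j(2,3) yd(2)[OF yd(1)] by (simp add: point_color_def)
        fix j' y' assume h: "j' < m" "y' < p" "(j', y') \<noteq> (i, x)" "point_color p g (i, x) (j', y') = (c, d)"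
        from h(4) 4 have "i \<noteq> j'" "g i j' = c - 1" "diff_mod p i j' x y' = d"
          by (auto simp: point_color_def split: if_splits)
        then show "j' = j \<and> y' = yd" using h(1,2) yd(2)[of y'] j(4) by metis
      qed (use j(1,2) yd(1) in simp_all)
    qed
  qed
  show ?thesis
    unfolding one_fact_def
  proof (intro conjI ballI impI)
    fix a b assume ab: "a \<in> {0..<m} \<times> {0..<p}" "b \<in> {0..<m} \<times> {0..<p}" "a \<noteq> b"
    obtain i x j y where eq: "a = (i, x)" "b = (j, y)" by (metis surj_pair)
    have "point_color p g a b \<in> colors m p \<and> point_color p g a b = point_color p g b a"
      unfolding eq by (rule closed) (use ab in \<open>simp_all add: eq\<close>)
    then show "point_color p g a b \<in> colors m p" "point_color p g a b = point_color p g b a" by blast+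
  next
    fix a \<kappa> assume a: "a \<in> {0..<m} \<times> {0..<p}" and \<kappa>: "\<kappa> \<in> colors m p"
    obtain i x c d where eq: "a = (i, x)" "\<kappa> = (c, d)" by (metis surj_pair)
    show "\<exists>!b. b \<in> {0..<m} \<times> {0..<p} \<and> b \<noteq> a \<and> point_color p g a b = \<kappa>"
      unfolding eq by (rule unique) (use a \<kappa> in \<open>simp_all add: eq\<close>)
  qed
qed

text \<open>Both columns grow by 1: classes 0 and 1 carry sums, which grow by 2, and the other
  classes carry differences, which stay.\<close>

definition shift_color :: "nat \<Rightarrow> color \<Rightarrow> color" where
  "shift_color p = (\<lambda>(c, d). if c \<le> 1 then (c, (d + 2) mod int p) else (c, d))"

lemma point_color_rot:
  assumes "x < p" "y < p"
  shows "point_color p g (rot p 1 (i, x)) (rot p 1 (j, y)) = shift_color p (point_color p g (i, x) (j, y))"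
proof -
  have "(x + 1) mod p = (y + 1) mod p \<longleftrightarrow> x = y"
    using assms by (metis cong_add_rcancel_nat cong_def mod_less)
  moreover have "sum_mod p ((x + 1) mod p) ((y + 1) mod p) = (sum_mod p x y + 2) mod int p"
  proof -
    have "int x + int 1 + (int y + int 1) = int x + int y + 2" by simp
    then show ?thesis
      unfolding sum_mod_def zmod_int of_nat_add mod_add_left_eq mod_add_right_eq by (rule arg_cong)
  qed
  moreover have "diff_mod p i j ((x + 1) mod p) ((y + 1) mod p) = diff_mod p i j x y"
  proof -
    have "(int ((b + 1) mod p) - int ((a + 1) mod p)) mod int p = (int b - int a) mod int p" for a b
      unfolding zmod_int of_nat_add mod_diff_left_eq mod_diff_right_eq by simp
    then show ?thesis unfolding diff_mod_def by (cases "i < j") simp_all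
  qed
  ultimately show ?thesis
    by (simp add: point_color_def rot_def shift_color_def)
qed

text \<open>Negating a nonzero difference has no fixed point for odd p and commutes with the shift,
  which leaves differences alone. Among the colours with d = 0 the classes 4, ..., m - 1 are paired
  consecutively, which works because m is even. Class 2 has no such colour, so (3, 0) alone stays
  fixed.\<close>

definition swap_color :: "nat \<Rightarrow> color \<Rightarrow> color" where
  "swap_color p = (\<lambda>(c, d).
     if c = 0 then (1, d) else if c = 1 then (0, d)
     else if d \<noteq> 0 then (c, int p - d)
     else if c = 3 then (3, 0)
     else if even c then (c + 1, 0) else (c - 1, 0))"

lemma swap_color:
  assumes "even m" "m \<ge> 4" "odd p" "\<kappa> \<in> colors m p"
  shows "swap_color p \<kappa> \<in> colors m p" "swap_color p (swap_color p \<kappa>) = \<kappa>"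
    "swap_color p \<kappa> = \<kappa> \<longleftrightarrow> \<kappa> = (3, 0)"
    "swap_color p (shift_color p \<kappa>) = shift_color p (swap_color p \<kappa>)"
proof -
  obtain c d where \<kappa>: "\<kappa> = (c, d)" by (cases \<kappa>)
  have cd: "c < m" "0 \<le> d" "d < int p" "c = 2 \<longrightarrow> d \<noteq> 0" using assms(4) by (auto simp: \<kappa> colors_def)
  have "int p - d \<noteq> d" using assms(3) by presburger
  have "c = 0 \<or> c = 1 \<or> c \<ge> 2 \<and> d \<noteq> 0 \<or> c = 3 \<and> d = 0 \<or> c \<ge> 4 \<and> even c \<and> d = 0 \<or> c \<ge> 5 \<and> odd c \<and> d = 0"
    using cd(4) by presburger
  then consider "c = 0" | "c = 1" | "c \<ge> 2" "d \<noteq> 0" | "c = 3" "d = 0" | "c \<ge> 4" "even c" "d = 0" | "c \<ge> 5" "odd c" "d = 0"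
    by blast
  then have "swap_color p \<kappa> \<in> colors m p \<and> swap_color p (swap_color p \<kappa>) = \<kappa> \<and>
    (swap_color p \<kappa> = \<kappa> \<longleftrightarrow> \<kappa> = (3, 0)) \<and> swap_color p (shift_color p \<kappa>) = shift_color p (swap_color p \<kappa>)"
  proof cases
    case 5
    then have "Suc c < m" using cd(1) assms(1) by presburger
    then show ?thesis using 5 cd by (simp add: \<kappa> swap_color_def colors_def shift_color_def)
  next
    case 6
    then have "even (c - 1)" "c - 1 \<ge> 4" "c - 1 < m" "c - 1 \<noteq> c" using cd(1) by simp_all
    then show ?thesis using 6 cd by (simp add: \<kappa> swap_color_def colors_def shift_color_def)
  qed (use cd assms(2) \<open>int p - d \<noteq> d\<close> in \<open>simp_all add: \<kappa> swap_color_def colors_def shift_color_def\<close>)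
  then show "swap_color p \<kappa> \<in> colors m p" "swap_color p (swap_color p \<kappa>) = \<kappa>"
    "swap_color p \<kappa> = \<kappa> \<longleftrightarrow> \<kappa> = (3, 0)"
    "swap_color p (shift_color p \<kappa>) = shift_color p (swap_color p \<kappa>)" by blast+
qed

section \<open>Doubling the rows and doubling the period\<close>

lemma doubling_points:
  assumes S: "cyclic_sqs m p \<B>" and m: "even m" "m \<ge> 4" and p: "p > 0"
    and \<pi>: "\<And>\<kappa>. \<kappa> \<in> colors m p \<Longrightarrow> \<pi> \<kappa> \<in> colors m p" "\<And>\<kappa>. \<kappa> \<in> colors m p \<Longrightarrow> \<pi> (\<pi> \<kappa>) = \<kappa>"
  shows "doubling ({0..<m} \<times> {0..<p}) \<B> (colors m p) (point_color p (clique_color m)) \<pi>"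
  using S m p \<pi> one_fact_point_color[OF one_fact_clique, of m p]
  by unfold_locales (simp_all add: cyclic_sqs_def)

lemma double_rot:
  assumes S: "cyclic_sqs m p \<B>" and m: "even m" "m \<ge> 4" and p: "p > 0"
    and \<pi>: "\<And>\<kappa>. \<kappa> \<in> colors m p \<Longrightarrow> \<pi> \<kappa> \<in> colors m p" "\<And>\<kappa>. \<kappa> \<in> colors m p \<Longrightarrow> \<pi> (\<pi> \<kappa>) = \<kappa>"
      "\<And>\<kappa>. \<kappa> \<in> colors m p \<Longrightarrow> \<pi> (shift_color p \<kappa>) = shift_color p (\<pi> \<kappa>)"
    and f: "f = id \<or> f = Not" and B: "B \<in> double ({0..<m} \<times> {0..<p}) \<B> (point_color p (clique_color m)) \<pi>"
  shows "map_prod (rot p 1) f ` B \<in> double ({0..<m} \<times> {0..<p}) \<B> (point_color p (clique_color m)) \<pi>"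
proof -
  interpret doubling "{0..<m} \<times> {0..<p}" \<B> "colors m p" "point_color p (clique_color m)" \<pi>
    by (rule doubling_points[OF S m p \<pi>(1,2)])
  show ?thesis
  proof (rule double_map[where s = "rot p 1" and \<tau> = "shift_color p"])
    show "rot p 1 ` B \<in> \<B>" if "B \<in> \<B>" for B using S that by (simp add: cyclic_sqs_def)
    show "rot p 1 a \<in> {0..<m} \<times> {0..<p}" if "a \<in> {0..<m} \<times> {0..<p}" for a
      using that p by (cases a) (simp add: rot_def)
    show "inj_on (rot p 1) ({0..<m} \<times> {0..<p})" by (rule rot_inj)
    show "point_color p (clique_color m) (rot p 1 a) (rot p 1 b) = shift_color p (point_color p (clique_color m) a b)"
      if "a \<in> {0..<m} \<times> {0..<p}" "b \<in> {0..<m} \<times> {0..<p}" "a \<noteq> b" for a b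
      using that point_color_rot[of "snd a" p "snd b" "clique_color m" "fst a" "fst b"] by (cases a; cases b) simp
  qed (fact \<pi>(3) f B)+
qed

text \<open>The copies are stacked as two blocks of rows, so the shift never exchanges them and the
  identity can serve as \<open>\<pi>\<close>.\<close>

lemma cyclic_sqs_double:
  assumes S: "cyclic_sqs m p \<B>" and m: "even m" "m \<ge> 4" and p: "p > 0"
  shows "\<exists>\<B>. cyclic_sqs (2 * m) p \<B>"
proof -
  let ?P = "{0..<m} \<times> {0..<p}" and ?\<D> = "double ({0..<m} \<times> {0..<p}) \<B> (point_color p (clique_color m)) id"
  interpret doubling ?P \<B> "colors m p" "point_color p (clique_color m)" id
    by (rule doubling_points[OF S m p]) simp_all
  define \<phi> where "\<phi> = (\<lambda>((i, x), e). (i + m * of_bool e, x) :: nat \<times> nat)"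
  have "bij_betw \<phi> (?P \<times> UNIV) ({0..<2 * m} \<times> {0..<p})"
  proof (rule bij_betw_byWitness[where f' = "\<lambda>(i, x). if i < m then ((i, x), False) else ((i - m, x), True)"])
  qed (auto simp: \<phi>_def split: if_splits)
  then have sqs: "sqs ({0..<2 * m} \<times> {0..<p}) ((`) \<phi> ` ?\<D>)" using sqs_image[OF sqs_double] by blast
  have "rot p 1 ` \<phi> ` B \<in> (`) \<phi> ` ?\<D>" if B: "B \<in> ?\<D>" for B
  proof -
    have "rot p 1 (\<phi> q) = \<phi> (map_prod (rot p 1) id q)" for q
      by (auto simp: \<phi>_def rot_def split: prod.splits)
    then have eq: "rot p 1 ` \<phi> ` B = \<phi> ` map_prod (rot p 1) id ` B" by (simp add: image_image)
    show ?thesis unfolding eq by (rule imageI, rule double_rot[OF S m p]) (use B in simp_all)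
  qed
  then have "cyclic_sqs (2 * m) p ((`) \<phi> ` ?\<D>)" using sqs by (auto simp: cyclic_sqs_def)
  then show ?thesis ..
qed

text \<open>By the Chinese remainder theorem a column modulo 2p is its residue modulo p together
  with its parity, and the parity names the copy. The shift by 1 exchanges the copies. The shift by
  p does nothing else, so the short blocks are the ones counted in
  \<open>card_flip_fixed\<close>.\<close>

lemma cyclic_sqs_twice_period:
  assumes S: "cyclic_sqs m p \<B>" and m: "even m" "m \<ge> 4" and p: "odd p"
  shows "\<exists>\<B>. cyclic_sqs m (2 * p) \<B> \<and> 4 * card {B \<in> \<B>. rot (2 * p) p ` B = B} = m * (2 * p)"
proof -
  let ?P = "{0..<m} \<times> {0..<p}"
    and ?\<D> = "double ({0..<m} \<times> {0..<p}) \<B> (point_color p (clique_color m)) (swap_color p)"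
  have p0: "p > 0" using p by (rule odd_pos)
  note swap = swap_color[OF m p]
  interpret doubling ?P \<B> "colors m p" "point_color p (clique_color m)" "swap_color p"
    by (rule doubling_points[OF S m p0]) (simp_all add: swap)
  define \<psi> where "\<psi> = (\<lambda>(i, y). ((i, y mod p), odd y) :: (nat \<times> nat) \<times> bool)"
  \<comment> \<open>For odd p the columns \<open>x\<close> and \<open>x + p\<close> have opposite
    parity; the one of parity e is chosen.\<close>
  define \<phi> where "\<phi> = (\<lambda>((i, x), e). (i, if odd x = e then x else x + p) :: nat \<times> nat)"
  have \<phi>\<psi>: "\<phi> (\<psi> (i, y)) = (i, y)" if "y < 2 * p" for i y
  proof (cases "y < p")
    case False
    then have "y mod p = y - p" using that by (simp add: mod_if)
    then show ?thesis using False p by (simp add: \<phi>_def \<psi>_def)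
  qed (simp add: \<phi>_def \<psi>_def)
  have \<psi>\<phi>: "\<psi> (\<phi> ((i, x), e)) = ((i, x), e)" if "x < p" for i x e
    using that p by (auto simp: \<phi>_def \<psi>_def)
  have \<phi>_lt: "snd (\<phi> q) < 2 * p" if "q \<in> ?P \<times> UNIV" for q using that by (auto simp: \<phi>_def)
  have bij: "bij_betw \<phi> (?P \<times> UNIV) ({0..<m} \<times> {0..<2 * p})"
  proof (rule bij_betw_byWitness[where f' = \<psi>])
    show "\<forall>a\<in>?P \<times> UNIV. \<psi> (\<phi> a) = a" using \<psi>\<phi> by auto
    show "\<forall>a\<in>{0..<m} \<times> {0..<2 * p}. \<phi> (\<psi> a) = a" using \<phi>\<psi> by auto
    show "\<phi> ` (?P \<times> UNIV) \<subseteq> {0..<m} \<times> {0..<2 * p}" by (auto simp: \<phi>_def)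
    show "\<psi> ` ({0..<m} \<times> {0..<2 * p}) \<subseteq> ?P \<times> UNIV" using p0 by (auto simp: \<psi>_def)
  qed
  have \<psi>_rot: "\<psi> (rot (2 * p) r (i, y)) = map_prod (rot p r) (\<lambda>e. odd r \<noteq> e) (\<psi> (i, y))" for r i y
  proof -
    have "even ((y + r) mod (2 * p)) \<longleftrightarrow> even (y + r)" by (rule dvd_mod_iff) simp
    then show ?thesis by (auto simp: \<psi>_def rot_def mod_simps mod_mod_cancel)
  qed
  have rot_\<phi>: "rot (2 * p) r (\<phi> q) = \<phi> (map_prod (rot p r) (\<lambda>e. odd r \<noteq> e) q)" if q: "q \<in> ?P \<times> UNIV" for r q
  proof -
    obtain i x e where eq: "q = ((i, x), e)" "x < p" using q by auto
    obtain j y where jy: "\<phi> q = (j, y)" by (cases "\<phi> q")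
    obtain k z where kz: "rot (2 * p) r (j, y) = (k, z)" "z < 2 * p" using p0 by (simp add: rot_def)
    have "\<phi> (\<psi> (rot (2 * p) r (\<phi> q))) = rot (2 * p) r (\<phi> q)" unfolding jy kz(1) by (rule \<phi>\<psi>[OF kz(2)])
    moreover have "\<psi> (rot (2 * p) r (\<phi> q)) = map_prod (rot p r) (\<lambda>e. odd r \<noteq> e) q"
      using \<psi>_rot[of r j y] \<psi>\<phi>[OF eq(2), of i e] by (simp add: jy[symmetric] eq(1)[symmetric])
    ultimately show ?thesis by simp
  qed
  have block: "B \<subseteq> ?P \<times> UNIV" if "B \<in> ?\<D>" for B by (rule sqs_block(1)[OF sqs_double that])
  have rot_image: "rot (2 * p) r ` \<phi> ` B = \<phi> ` map_prod (rot p r) (\<lambda>e. odd r \<noteq> e) ` B" if "B \<in> ?\<D>" for r B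
    unfolding image_image by (rule image_cong[OF refl], rule rot_\<phi>) (use block[OF that] in blast)
  have sqs: "sqs ({0..<m} \<times> {0..<2 * p}) ((`) \<phi> ` ?\<D>)" by (rule sqs_image[OF sqs_double bij])
  have "rot (2 * p) 1 ` \<phi> ` B \<in> (`) \<phi> ` ?\<D>" if B: "B \<in> ?\<D>" for B
  proof -
    have Not: "(\<lambda>e. odd (1::nat) \<noteq> e) = Not" by auto
    show ?thesis unfolding rot_image[OF B] Not
      by (rule imageI, rule double_rot[OF S m p0]) (use B swap in simp_all)
  qed
  then have "cyclic_sqs m (2 * p) ((`) \<phi> ` ?\<D>)" using sqs by (auto simp: cyclic_sqs_def)
  moreover have "4 * card {B \<in> (`) \<phi> ` ?\<D>. rot (2 * p) p ` B = B} = m * (2 * p)"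
  proof -
    have inj: "inj_on \<phi> (?P \<times> UNIV)" using bij by (simp add: bij_betw_def)
    have iff: "rot (2 * p) p ` \<phi> ` B = \<phi> ` B \<longleftrightarrow> map_prod id Not ` B = B" if B: "B \<in> ?\<D>" for B
    proof -
      have "map_prod (rot p p) (\<lambda>e. odd p \<noteq> e) q = map_prod id Not q" if "q \<in> B" for q
      proof -
        obtain i x e where "q = ((i, x), e)" "x < p" using block[OF B] \<open>q \<in> B\<close> by auto
        then show ?thesis using p by (simp add: rot_def)
      qed
      then have eq: "rot (2 * p) p ` \<phi> ` B = \<phi> ` map_prod id Not ` B" unfolding rot_image[OF B] by simp
      have "map_prod id Not ` B \<subseteq> ?P \<times> UNIV" using block[OF B] by auto
      then show ?thesis unfolding eq using inj_on_image_eq_iff[OF inj _ block[OF B]] by blast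
    qed
    have "{B \<in> (`) \<phi> ` ?\<D>. rot (2 * p) p ` B = B} = (`) \<phi> ` {B \<in> ?\<D>. map_prod id Not ` B = B}"
    proof (intro equalityI subsetI)
      fix X assume "X \<in> {B \<in> (`) \<phi> ` ?\<D>. rot (2 * p) p ` B = B}"
      then obtain B where B: "B \<in> ?\<D>" "X = \<phi> ` B" "rot (2 * p) p ` \<phi> ` B = \<phi> ` B" by blast
      then show "X \<in> (`) \<phi> ` {B \<in> ?\<D>. map_prod id Not ` B = B}"
        unfolding B(2) by (intro imageI CollectI conjI iffD1[OF iff])
    next
      fix X assume "X \<in> (`) \<phi> ` {B \<in> ?\<D>. map_prod id Not ` B = B}"
      then obtain B where B: "B \<in> ?\<D>" "X = \<phi> ` B" "map_prod id Not ` B = B" by blast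
      then show "X \<in> {B \<in> (`) \<phi> ` ?\<D>. rot (2 * p) p ` B = B}"
        unfolding B(2) by (intro imageI CollectI conjI iffD2[OF iff])
    qed
    moreover have "inj_on ((`) \<phi>) {B \<in> ?\<D>. map_prod id Not ` B = B}"
      by (rule inj_onI) (metis (no_types, lifting) block inj inj_on_image_eq_iff mem_Collect_eq)
    ultimately have "card {B \<in> (`) \<phi> ` ?\<D>. rot (2 * p) p ` B = B} = card {B \<in> ?\<D>. map_prod id Not ` B = B}"
      by (simp add: card_image)
    moreover have "4 * card {B \<in> ?\<D>. map_prod id Not ` B = B} = card (?P \<times> (UNIV :: bool set))"
      by (rule card_flip_fixed[of "(3, 0)"]) (use swap(3) m p0 in \<open>simp_all add: colors_def\<close>)
    ultimately show ?thesis by (simp add: card_cartesian_product)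
  qed
  ultimately show ?thesis by blast
qed

section \<open>The optimal codes\<close>

definition orbit :: "nat \<Rightarrow> (nat \<times> nat) set \<Rightarrow> (nat \<times> nat) set set" where
  "orbit v B = (\<lambda>r. rot v r ` B) ` {0..<v}"

lemma rot_mem_orbit: "v > 0 \<Longrightarrow> rot v r ` B \<in> orbit v B"
  unfolding orbit_def by (rule image_eqI[of _ _ "r mod v"]) (simp_all add: rot_mod)

lemma orbit_subset:
  assumes "v > 0" "A \<in> orbit v B"
  shows "orbit v A \<subseteq> orbit v B"
proof
  fix X assume "X \<in> orbit v A"
  then obtain r where "X = rot v r ` A" by (auto simp: orbit_def)
  moreover obtain s where "A = rot v s ` B" using assms(2) by (auto simp: orbit_def)
  ultimately have "X = rot v (r + s) ` B" by (simp add: rot_image_image)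
  then show "X \<in> orbit v B" using rot_mem_orbit[OF assms(1)] by simp
qed

lemma six_choose_three: "6 * int (n choose 3) = int n * (int n - 1) * (int n - 2)"
proof (induction n)
  case (Suc n)
  have "2 * int (n choose 2) = int n * (int n - 1)"
    by (induction n) (simp_all add: numeral_2_eq_2 algebra_simps)
  moreover have "Suc n choose 3 = (n choose 2) + (n choose 3)"
    by (simp add: numeral_eq_Suc)
  ultimately show ?case using Suc by (simp add: algebra_simps)
qed simp

text \<open>The code takes one block from every orbit that the shift by p does not fix; by
  \<open>rot_stabilizer\<close> these orbits have full length 2p. A correlation above 2 makes a
  shift of A share three cells with B, hence equal B. Then A and B represent the same orbit, so they
  coincide, and the shift is trivial because the orbit is full.\<close>

lemma ooc_of_sqs:
  assumes S: "cyclic_sqs u (2 * p) \<B>" and p: "coprime p 6" "p > 0"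
    and short: "4 * card {B \<in> \<B>. rot (2 * p) p ` B = B} = u * (2 * p)"
  obtains C where "finite C" "is_2D_OOC u (2 * p) C"
    "24 * int (card C) = int u * ((2 * int u * int p - 1) * (2 * int u * int p - 2) - 6)"
proof -
  define v where "v = 2 * p"
  have v: "v > 0" using p by (simp add: v_def)
  note sqs = S[unfolded cyclic_sqs_def, THEN conjunct1, folded v_def]
  have block: "B \<subseteq> {0..<u} \<times> {0..<v}" "card B = 4" if "B \<in> \<B>" for B
    using sqs_block[OF sqs that] by auto
  have rotB: "rot v r ` B \<in> \<B>" if "B \<in> \<B>" for r B
    using cyclic_sqs_rot[OF S that] by (simp add: v_def)
  have inj: "A = B" if "A \<in> \<B>" "B \<in> \<B>" "rot v r ` A = rot v r ` B" for A B r
    using inj_on_image_eq_iff[OF rot_inj block(1)[OF that(1)] block(1)[OF that(2)]] that(3) by blast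
  define \<F> where "\<F> = {B \<in> \<B>. rot v p ` B \<noteq> B}"
  have \<F>B: "B \<in> \<B>" if "B \<in> \<F>" for B using that by (simp add: \<F>_def)
  have rotF: "rot v r ` B \<in> \<F>" if "B \<in> \<F>" for r B
  proof -
    have B: "B \<in> \<B>" "rot v p ` B \<noteq> B" using that by (auto simp: \<F>_def)
    have "rot v p ` rot v r ` B = rot v r ` rot v p ` B" by (simp add: rot_image_image add.commute)
    then have "rot v p ` rot v r ` B \<noteq> rot v r ` B" using inj[OF rotB[OF B(1)] B(1)] B(2) by metis
    then show ?thesis using rotB[OF B(1)] by (simp add: \<F>_def)
  qed
  have free: "v dvd r" if "B \<in> \<F>" "rot v r ` B = B" for r B
    using rot_stabilizer[of B u p r] block[OF \<F>B[OF that(1)]] p(1) that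
    by (auto simp: \<F>_def v_def)
  have orbF: "orbit v B \<subseteq> \<F>" if "B \<in> \<F>" for B using rotF[OF that] by (auto simp: orbit_def)
  have card_orbit: "card (orbit v B) = v" if B: "B \<in> \<F>" for B
  proof -
    have "rot v r ` B \<noteq> rot v s ` B" if "r < s" "s < v" for r s
    proof
      assume "rot v r ` B = rot v s ` B"
      also have "\<dots> = rot v r ` rot v (s - r) ` B" using that by (simp add: rot_image_image)
      finally have "B = rot v (s - r) ` B" using inj \<F>B[OF B] rotB by blast
      then have "v dvd s - r" using free[OF B] by simp
      then show False using that by (simp add: nat_dvd_not_less)
    qed
    then have "inj_on (\<lambda>r. rot v r ` B) {0..<v}"
      by (intro inj_onI) (metis atLeastLessThan_iff linorder_neqE_nat)
    then show ?thesis by (simp add: orbit_def card_image)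
  qed
  have orbit_eq: "orbit v A = orbit v B" if "A \<in> orbit v B" "B \<in> \<F>" for A B
  proof (rule card_subset_eq)
    have "A \<in> \<F>" using orbF[OF that(2)] that(1) by blast
    then show "card (orbit v A) = card (orbit v B)" using card_orbit that(2) by metis
  qed (use orbit_subset[OF v that(1)] in \<open>simp_all add: orbit_def\<close>)
  have self: "B \<in> orbit v B" if "B \<in> \<F>" for B
    using rot_mem_orbit[OF v, of 0 B] rot_id[OF block(1)[OF \<F>B[OF that]], of 0] by simp
  define \<O> where "\<O> = orbit v ` \<F>"
  have fin: "finite \<F>" using sqs_finite[OF sqs] by (simp add: \<F>_def)
  have disj: "X \<inter> Y = {}" if XY: "X \<in> \<O>" "Y \<in> \<O>" "X \<noteq> Y" for X Y
  proof (rule ccontr)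
    obtain A B where AB: "A \<in> \<F>" "B \<in> \<F>" "X = orbit v A" "Y = orbit v B" using XY(1,2) by (auto simp: \<O>_def)
    assume "X \<inter> Y \<noteq> {}"
    then obtain D where "D \<in> orbit v A" "D \<in> orbit v B" using AB(3,4) by blast
    then show False using orbit_eq AB XY(3) by metis
  qed
  have union: "\<Union>\<O> = \<F>" using orbF self by (auto simp: \<O>_def)
  have card_\<O>: "v * card \<O> = card \<F>"
  proof -
    have "v * card \<O> = card (\<Union>\<O>)"
    proof (rule card_partition)
      show "card X = v" if "X \<in> \<O>" for X using that card_orbit by (auto simp: \<O>_def)
    qed (use fin union disj in \<open>simp_all add: \<O>_def\<close>)
    then show ?thesis using union by simp
  qed
  define rep where "rep X = (SOME B. B \<in> X)" for X :: "(nat \<times> nat) set set"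
  have rep: "rep X \<in> X" if "X \<in> \<O>" for X
  proof -
    have "\<exists>B. B \<in> X" using that self by (auto simp: \<O>_def)
    then show ?thesis unfolding rep_def by (rule someI_ex)
  qed
  define C where "C = rep ` \<O>"
  have inj_rep: "inj_on rep \<O>"
    by (intro inj_onI) (metis disj rep disjoint_iff)
  have C\<F>: "A \<in> \<F>" if "A \<in> C" for A using that rep union by (auto simp: C_def)
  have C_eq: "A = B" if CC: "A \<in> C" "B \<in> C" "B \<in> orbit v A" for A B
  proof -
    obtain X Y where XY: "X \<in> \<O>" "Y \<in> \<O>" "A = rep X" "B = rep Y" using CC by (auto simp: C_def)
    have "orbit v A \<in> \<O>" using C\<F>[OF CC(1)] by (simp add: \<O>_def)
    moreover have "A \<in> orbit v A \<inter> X" "B \<in> Y \<inter> orbit v A"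
      using self[OF C\<F>[OF CC(1)]] rep XY CC(3) by auto
    ultimately have "X = orbit v A" "Y = orbit v A" using disj XY(1,2) by (metis emptyE)+
    then show ?thesis using XY by simp
  qed
  have corr_le: "corr v A B r \<le> 2" if AB: "A \<in> C" "B \<in> C" "A \<noteq> B \<or> r mod int v \<noteq> 0" for A B r
  proof (rule ccontr)
    assume "\<not> corr v A B r \<le> 2"
    \<comment> \<open>Correlations use integer shifts, \<open>rot\<close> natural ones; s is the
      least residue of r.\<close>
    define s where "s = nat (r mod int v)"
    have s: "nat ((int j + r) mod int v) = (j + s) mod v" for j
    proof -
      have "(int j + r) mod int v = (int j + int s) mod int v"
        using v by (simp add: s_def mod_simps)
      then show ?thesis by (metis nat_int of_nat_add zmod_int)
    qed
    let ?T = "{q \<in> A. rot v s q \<in> B}"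
    have "corr v A B r = card ?T"
      unfolding corr_def s rot_def by (rule arg_cong[of _ _ card]) auto
    then have T: "card ?T \<ge> 3" using \<open>\<not> corr v A B r \<le> 2\<close> by simp
    have A: "A \<in> \<B>" and B: "B \<in> \<B>" using C\<F> \<F>B AB by blast+
    have "inj_on (rot v s) ?T"
      by (rule inj_on_subset[OF rot_inj[of v s u]]) (use block(1)[OF A] in blast)
    then have "card (rot v s ` ?T) \<ge> 3" using T by (simp add: card_image)
    moreover have "rot v s ` ?T \<subseteq> rot v s ` A \<inter> B" by auto
    moreover have "finite (rot v s ` A \<inter> B)" using block(2)[OF B] by (metis card.infinite finite_Int zero_neq_numeral)
    ultimately have "card (rot v s ` A \<inter> B) \<ge> 3" by (meson card_mono le_trans)
    then have eq: "rot v s ` A = B" using sqs_unique[OF sqs rotB[OF A] B] by blast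
    then have "A = B" using C_eq[OF AB(1,2)] rot_mem_orbit[OF v] by blast
    then have "v dvd s" using free[OF C\<F>[OF AB(1)]] eq by blast
    moreover have "s < v" using v by (simp add: s_def nat_less_iff)
    ultimately have "s = 0" using nat_dvd_not_less by blast
    moreover have "r mod int v \<ge> 0" using v by simp
    ultimately have "r mod int v = 0" by (simp add: s_def)
    then show False using AB(3) \<open>A = B\<close> by simp
  qed
  have "is_2D_OOC u v C"
    unfolding is_2D_OOC_def ooc_matrix_def using corr_le block C\<F> \<F>B by blast
  moreover have "finite C" using fin by (simp add: C_def \<O>_def)
  moreover have "24 * int (card C) = int u * ((2 * int u * int p - 1) * (2 * int u * int p - 2) - 6)"
  proof -
    define N where "N = u * v"
    define S where "S = {B \<in> \<B>. rot v p ` B = B}"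
    have "\<B> = S \<union> \<F>" "S \<inter> \<F> = {}" by (auto simp: \<F>_def S_def)
    moreover have "finite S" using sqs_finite[OF sqs] by (simp add: S_def)
    ultimately have "card \<B> = card S + card \<F>" using fin card_Un_disjoint by metis
    moreover have "card C = card \<O>" using inj_rep by (simp add: C_def card_image)
    ultimately have 1: "card \<B> = card S + v * card C" using card_\<O> by simp
    have "4 * card \<B> = N choose 3" using card_sqs[OF sqs] by (simp add: N_def)
    then have "24 * int (card \<B>) = int N * (int N - 1) * (int N - 2)"
      using six_choose_three[of N] by simp
    moreover have "4 * card S = N" using short by (simp add: N_def v_def S_def)
    \<comment> \<open>The term 6N is 24 times the number N/4 of short blocks; cancelling v turns it
      into the 6 in the claim.\<close>
    ultimately have "6 * int N + 24 * int v * int (card C) = int N * (int N - 1) * (int N - 2)"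
      using 1 by simp
    then have "int v * (24 * int (card C)) = int v * (int u * ((int N - 1) * (int N - 2) - 6))"
      by (simp add: N_def algebra_simps)
    then have "24 * int (card C) = int u * ((int N - 1) * (int N - 2) - 6)" using v by simp
    then show ?thesis by (simp add: N_def v_def algebra_simps)
  qed
  ultimately show ?thesis using that by (simp add: v_def)
qed

text \<open>Every floor is taken at an integer. For the middle one, 3 divides (2m - 1)(m - 1)
  because it does not divide m = up. The outer one needs no divisibility argument: the hypothesis on
  c exhibits its argument as the integer c.\<close>

lemma J_star_eq:
  assumes "\<not> 3 dvd u * p" "u * p > 0" "24 * int c = int u * ((2 * int u * int p - 1) * (2 * int u * int p - 2) - 6)"
  shows "int c = J_star u p"
proof -
  define m where "m = int u * int p"
  have "\<not> 3 dvd m" using assms(1) unfolding m_def by (metis int_dvd_int_iff of_nat_mult of_nat_numeral)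
  then have "m mod 3 = 1 \<or> m mod 3 = 2" by presburger
  then have "3 dvd (2 * m - 1) * (m - 1)"
  proof
    assume "m mod 3 = 1"
    then have "3 dvd m - 1" by presburger
    then show ?thesis by simp
  next
    assume "m mod 3 = 2"
    then have "3 dvd 2 * m - 1" by presburger
    then show ?thesis by simp
  qed
  then obtain q where q: "(2 * m - 1) * (m - 1) = 3 * q" by blast
  have "(2 * m - 1) * (2 * m - 2) = 2 * ((2 * m - 1) * (m - 1))" by (simp add: algebra_simps)
  then have e: "(2 * m - 1) * (2 * m - 2) = 6 * q" unfolding q by simp
  have "2 * int u * int p = 2 * m" by (simp add: m_def)
  from assms(3)[unfolded this e] have "24 * int c = int u * (6 * q - 6)" .
  then have c: "4 * int c = int u * (q - 1)" by (simp add: algebra_simps)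
  have rm: "real u * real p = real_of_int m" by (simp add: m_def)
  have rm2: "2 * real u * real p = 2 * real_of_int m" using rm by simp
  have f2: "\<lfloor>(2 * real u * real p - 2) / 2\<rfloor> = m - 1"
  proof -
    have "(2 * real u * real p - 2) / 2 = real_of_int (m - 1)" unfolding rm2 by simp
    then show ?thesis by (metis floor_of_int)
  qed
  have f1: "\<lfloor>((2 * real u * real p - 1) / 3) * real_of_int (m - 1)\<rfloor> = q"
  proof -
    have "real_of_int ((2 * m - 1) * (m - 1)) = real_of_int (3 * q)" using q by simp
    then have "((2 * real u * real p - 1) / 3) * real_of_int (m - 1) = real_of_int q"
      unfolding rm2 by simp
    then show ?thesis by (metis floor_of_int)
  qed
  have "real_of_int (4 * int c) = real_of_int (int u * (q - 1))" using c by simp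
  then have "(real u / 4) * (real_of_int q - 1) = real_of_int (int c)" by simp
  then show ?thesis unfolding J_star_def f2 f1 by (metis floor_of_int)
qed

section \<open>All admissible numbers of rows\<close>

lemma cyclic_sqs_power:
  assumes "coprime (k * p) 6" "k * p > 0"
  shows "\<exists>\<B>. cyclic_sqs (4 * k * 2 ^ j) p \<B>"
proof (induction j)
  case 0
  then show ?case using cyclic_sqs_base[OF assms] by simp
next
  case (Suc j)
  then obtain \<B> where "cyclic_sqs (4 * k * 2 ^ j) p \<B>" by blast
  moreover have "4 \<le> 4 * k * 2 ^ j" "p > 0" using assms(2) by simp_all
  ultimately have "\<exists>\<B>. cyclic_sqs (2 * (4 * k * 2 ^ j)) p \<B>" by (intro cyclic_sqs_double) simp_all
  then show ?case by (simp add: mult.left_commute)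
qed

lemma coprime_sixI:
  fixes k :: nat
  assumes "odd k" "\<not> 3 dvd k"
  shows "coprime k 6"
proof -
  have "k mod 6 = 1 \<or> k mod 6 = 5" using assms by presburger
  moreover have "coprime (5 :: nat) 6" using coprime_Suc_right_nat[of 5] by simp
  ultimately show ?thesis
    by (metis coprime_mod_left_iff coprime_1_left zero_neq_numeral)
qed

theorem theorem9p7:
  fixes p u :: nat
  assumes "prime p"
    and "p mod 12 = 7 \<or> p \<in> {37, 61, 73, 109, 157, 181, 229, 277}"
    and "u mod 24 = 8 \<or> u mod 24 = 16"
  shows "\<exists>C. finite C \<and> is_2D_OOC u (2 * p) C \<and> int (card C) = J_star u p"
proof -
  \<comment> \<open>The eight listed primes are all 1 modulo 12.\<close>
  have "p mod 12 = 7 \<or> p mod 12 = 1" using assms(2) by auto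
  then have p: "odd p" "\<not> 3 dvd p" by presburger+
  have u: "u > 0" "\<not> 3 dvd u" "4 dvd u" using assms(3) by presburger+
  then obtain w where w: "u = 4 * w" "w \<noteq> 0" by auto
  \<comment> \<open>The odd part k of u/4 goes into the linear system on 4kp points; the power of 2
    is regained by repeated doubling of the rows.\<close>
  obtain k where k: "w = 2 ^ multiplicity 2 w * k" "odd k"
    using multiplicity_decompose'[of w 2] w(2) by auto
  define j where "j = multiplicity 2 w"
  have "w = 2 ^ j * k" unfolding j_def by (fact k(1))
  then have uk: "u = 4 * k * 2 ^ j" using w(1) by simp
  have "\<not> 3 dvd k" using u(2) uk by auto
  then have "coprime (k * p) 6" using coprime_sixI k(2) p by simp
  moreover have "k * p > 0" using k(2) p(1) by (simp add: odd_pos)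
  ultimately obtain \<B> where "cyclic_sqs u p \<B>" using cyclic_sqs_power uk by blast
  moreover have "even u" "u \<ge> 4" using u by auto
  ultimately obtain \<D> where \<D>: "cyclic_sqs u (2 * p) \<D>"
      "4 * card {B \<in> \<D>. rot (2 * p) p ` B = B} = u * (2 * p)"
    using cyclic_sqs_twice_period p(1) by blast
  have "p > 0" using p(1) by (rule odd_pos)
  obtain C where C: "finite C" "is_2D_OOC u (2 * p) C"
      "24 * int (card C) = int u * ((2 * int u * int p - 1) * (2 * int u * int p - 2) - 6)"
    using ooc_of_sqs[OF \<D>(1) coprime_sixI[OF p] \<open>p > 0\<close> \<D>(2)] by blast
  have "\<not> 3 dvd u * p"
    using p(2) u(2) by (simp add: prime_dvd_mult_iff)
  then have "int (card C) = J_star u p"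
    using C(3) u(1) \<open>p > 0\<close> by (intro J_star_eq) simp_all
  then show ?thesis using C(1,2) by blast
qed

end
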